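(* Let $n\ge 2$ and let $\mathcal{D}$ be a separable drawing of the complete graph $K_n$. Then for each pair of vertices $v\neq w$ of $\mathcal{D}$, the drawing $\mathcal{D}$ contains a crossing-free subdrawing with at least $2n-3$ edges that in turn contains a Hamiltonian path (of $K_n$) with end-vertices $v$ and $w$.
   Context: A simple drawing of a graph is a representation in the plane (or on the sphere) in which vertices are mapped to distinct points and edges to Jordan arcs connecting their respective end-vertices (an edge passes through no vertex other than its end-vertices), such that every pair of edges has at most one point in common, which is either a common end-vertex or a proper crossing. An edge $e$ of a simple drawing $\mathcal{D}$ is a separator edge if there is a simple closed curve $\gamma_e$ containing $e$ such that the only vertices of $\mathcal{D}$ on $\gamma_e$ are the end-vertices of $e$ and such that $\gamma_e$ has at most one point in common with each edge $f\neq e$ of $\mathcal{D}$ (this point being a proper crossing or an end-vertex of $f$). A simple drawing is separable if every one of its edges is a separator edge. A subdrawing of $\mathcal{D}$ (the restriction of $\mathcal{D}$ to a subgraph) is crossing-free if no two of its edges cross each other. *)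

theory Defs
  imports "HOL-Analysis.Analysis"
begin

text \<open>
  A drawing of a finite simple graph. Edges are two-element vertex sets. Each edge has a
  parametrized arc, whose direction is irrelevant. Values of \<open>place\<close> and \<open>curve\<close> outside the
  vertex set and the edge set carry no meaning.
\<close>

record ('v, 'a) drawing =
  verts :: "'v set"
  edges :: "'v set set"
  place :: "'v \<Rightarrow> 'a"
  curve :: "'v set \<Rightarrow> real \<Rightarrow> 'a"

definition all_edges :: "'v set \<Rightarrow> 'v set set" where
  "all_edges V = {e. e \<subseteq> V \<and> card e = 2}"

abbreviation edge_image :: "('v, 'a::topological_space) drawing \<Rightarrow> 'v set \<Rightarrow> 'a set" where
  "edge_image D e \<equiv> path_image (curve D e)"

text \<open>
  Proper (transversal) crossing of two curves at \<open>x\<close> on the surface \<open>S\<close>: in some chart of \<open>S\<close>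
  around \<open>x\<close>, the two curves are the two coordinate axes of the open unit disc. In particular
  neither curve ends at \<open>x\<close>, and touching points are excluded.
\<close>

definition proper_crossing ::
    "'a::topological_space set \<Rightarrow> 'a set \<Rightarrow> 'a set \<Rightarrow> 'a \<Rightarrow> bool" where
  "proper_crossing S A B x \<longleftrightarrow>
     (\<exists>U (h :: 'a \<Rightarrow> complex) k.
        openin (top_of_set S) U \<and> x \<in> U \<and>
        homeomorphism U (ball 0 1) h k \<and> h x = 0 \<and>
        h ` (A \<inter> U) = {z \<in> ball 0 1. Im z = 0} \<and>
        h ` (B \<inter> U) = {z \<in> ball 0 1. Re z = 0})"

definition simple_drawing ::
    "'a::topological_space set \<Rightarrow> ('v, 'a) drawing \<Rightarrow> bool" where
  "simple_drawing S D \<longleftrightarrow>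
     finite (verts D) \<and> edges D \<subseteq> all_edges (verts D) \<and>
     inj_on (place D) (verts D) \<and> place D ` verts D \<subseteq> S \<and>
     (\<forall>e\<in>edges D.
        arc (curve D e) \<and> edge_image D e \<subseteq> S \<and>
        {pathstart (curve D e), pathfinish (curve D e)} = place D ` e \<and>
        edge_image D e \<inter> place D ` verts D = place D ` e) \<and>
     (\<forall>e\<in>edges D. \<forall>f\<in>edges D. e \<noteq> f \<longrightarrow>
        edge_image D e \<inter> edge_image D f = {} \<or>
        (\<exists>x. edge_image D e \<inter> edge_image D f = {x} \<and>
             (x \<in> place D ` (e \<inter> f) \<or>
              proper_crossing S (edge_image D e) (edge_image D f) x)))"

definition separator_edge ::
    "'a::topological_space set \<Rightarrow> ('v, 'a) drawing \<Rightarrow> 'v set \<Rightarrow> bool" where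
  "separator_edge S D e \<longleftrightarrow>
     (\<exists>\<gamma>. simple_path \<gamma> \<and> pathfinish \<gamma> = pathstart \<gamma> \<and> path_image \<gamma> \<subseteq> S \<and>
        edge_image D e \<subseteq> path_image \<gamma> \<and>
        path_image \<gamma> \<inter> place D ` verts D = place D ` e \<and>
        (\<forall>f\<in>edges D. f \<noteq> e \<longrightarrow>
           path_image \<gamma> \<inter> edge_image D f = {} \<or>
           (\<exists>x. path_image \<gamma> \<inter> edge_image D f = {x} \<and>
                (proper_crossing S (path_image \<gamma>) (edge_image D f) x \<or> x \<in> place D ` f))))"

definition separable_drawing ::
    "'a::topological_space set \<Rightarrow> ('v, 'a) drawing \<Rightarrow> bool" where
  "separable_drawing S D \<longleftrightarrow>
     simple_drawing S D \<and> (\<forall>e\<in>edges D. separator_edge S D e)"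

definition drawing_of_complete_graph :: "nat \<Rightarrow> ('v, 'a) drawing \<Rightarrow> bool" where
  "drawing_of_complete_graph n D \<longleftrightarrow>
     finite (verts D) \<and> card (verts D) = n \<and> edges D = all_edges (verts D)"

definition subdrawing :: "('v, 'a) drawing \<Rightarrow> ('v, 'a) drawing \<Rightarrow> bool" where
  "subdrawing D' D \<longleftrightarrow>
     (\<exists>V E. V \<subseteq> verts D \<and> E \<subseteq> edges D \<and> E \<subseteq> all_edges V \<and>
        D' = D\<lparr>verts := V, edges := E\<rparr>)"

definition crossing_free ::
    "'a::topological_space set \<Rightarrow> ('v, 'a) drawing \<Rightarrow> bool" where
  "crossing_free S D \<longleftrightarrow>
     (\<forall>e\<in>edges D. \<forall>f\<in>edges D. e \<noteq> f \<longrightarrow>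
        \<not> (\<exists>x. proper_crossing S (edge_image D e) (edge_image D f) x))"

definition hamiltonian_path ::
    "'v set \<Rightarrow> 'v set set \<Rightarrow> 'v \<Rightarrow> 'v \<Rightarrow> 'v list \<Rightarrow> bool" where
  "hamiltonian_path V E v w p \<longleftrightarrow>
     p \<noteq> [] \<and> distinct p \<and> set p = V \<and> successively (\<lambda>x y. {x, y} \<in> E) p \<and>
     hd p = v \<and> last p = w"

end

theory Submission
  imports Defs
begin

text \<open>
  Let \<open>v \<noteq> w\<close> and pick a third vertex \<open>x\<close>. The closed curve through the edge \<open>vx\<close> splits the
  other vertices into \<open>A\<close> and \<open>B\<close>, say with \<open>w \<in> B\<close>. By induction there are plane graphs on
  \<open>A \<union> {v, x}\<close> and \<open>B \<union> {x}\<close> with Hamiltonian paths from \<open>v\<close> to \<open>x\<close> and from \<open>x\<close> to \<open>w\<close>; they lie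
  on different sides of the curve, so their union is plane, and it is one edge short of
  \<open>2n - 3\<close>.

  The missing edge comes from a visibility argument: for a plane graph \<open>F\<close> on \<open>U\<close>, a vertex
  \<open>v \<notin> U\<close> and \<open>x \<in> U\<close>, some edge from \<open>v\<close> to \<open>U - {x}\<close> crosses no edge of \<open>F\<close>. If \<open>vy\<close> first
  meets \<open>F\<close> at a point \<open>X\<close> of the edge \<open>cd\<close>, consider the region bounded by \<open>vX\<close>, \<open>Xc\<close> and \<open>cv\<close>
  not containing \<open>d\<close>. An edge of \<open>F\<close> that crosses \<open>vc\<close> ends at a vertex \<open>p\<close> in this region, and
  separability of \<open>cd\<close> forces \<open>vp\<close> to stay inside. Restarting from \<open>vc\<close> and \<open>p\<close> gives a smaller
  region. The regions for \<open>c\<close> and \<open>d\<close> are disjoint, so one of them avoids \<open>x\<close>.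
\<close>

section \<open>The two sides of a closed curve\<close>

text \<open>\<open>P\<close> and \<open>Q\<close> are the two complementary domains of a Jordan
  curve \<open>C\<close> in \<open>S\<close>, each with all of \<open>C\<close> in its frontier.
  Nothing distinguishes an inner from an outer side, so plane and sphere are treated alike and the
  labels can be swapped.\<close>

definition sides :: "'a::topological_space set \<Rightarrow> 'a set \<Rightarrow> 'a set \<Rightarrow> 'a set \<Rightarrow> bool" where
  "sides S C P Q \<longleftrightarrow>
     openin (top_of_set S) P \<and> openin (top_of_set S) Q \<and> connected P \<and> connected Q \<and>
     P \<inter> Q = {} \<and> P \<union> Q = S - C \<and>
     (\<forall>x\<in>C. \<forall>U. openin (top_of_set S) U \<and> x \<in> U \<longrightarrow> U \<inter> P \<noteq> {} \<and> U \<inter> Q \<noteq> {})"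

lemma sides_sym: "sides S C P Q \<Longrightarrow> sides S C Q P"
  unfolding sides_def by (auto simp: Int_commute Un_commute)

lemma sides_disjoint: "sides S C P Q \<Longrightarrow> P \<inter> Q = {}"
  and sides_union: "sides S C P Q \<Longrightarrow> P \<union> Q = S - C"
  unfolding sides_def by simp_all

lemma sides_connected_subset:
  assumes "sides S C P Q" "connected K" "K \<subseteq> S" "K \<inter> C = {}"
  shows "K \<subseteq> P \<or> K \<subseteq> Q"
proof -
  have K: "K \<subseteq> P \<union> Q" and dis: "P \<inter> Q = {}"
    using assms unfolding sides_def by auto
  obtain P' Q' where P': "open P'" "P = S \<inter> P'" and Q': "open Q'" "Q = S \<inter> Q'"
    using assms(1) unfolding sides_def openin_open by auto
  have "P' \<inter> K = {} \<or> Q' \<inter> K = {}"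
    using connectedD[OF assms(2) P'(1) Q'(1)] K dis assms(3) P' Q' by blast
  then show ?thesis
    using K P' Q' by blast
qed

lemma sides_connected_mem:
  assumes "sides S C P Q" "connected K" "K \<subseteq> S" "K \<inter> C = {}" "z \<in> K" "z \<in> P"
  shows "K \<subseteq> P"
  using sides_connected_subset[OF assms(1-4)] assms(1,5,6) unfolding sides_def by blast

lemma sides_frontier:
  assumes "sides S C P Q" "openin (top_of_set S) U" "x \<in> C" "x \<in> U"
  shows "U \<inter> P \<noteq> {}" "U \<inter> Q \<noteq> {}"
  using assms unfolding sides_def by blast+

text \<open>The Jordan curve theorem is carried over from the complex plane by the chart
  \<open>h\<close>. For the plane \<open>E\<close> is empty; for the sphere it is a single point off
  the curve, which acts as the point at infinity and is added to the outer side.\<close>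

lemma sides_via_complex_chart:
  fixes S :: "'a::euclidean_space set" and h :: "'a \<Rightarrow> complex"
  assumes hom: "homeomorphism (S - E) (UNIV :: complex set) h k"
    and \<gamma>: "simple_path \<gamma>" "pathfinish \<gamma> = pathstart \<gamma>" "path_image \<gamma> \<subseteq> S - E"
    and E: "E = {} \<or> (\<exists>P. E = {P} \<and> P \<in> S \<and> P islimpt S)"
  shows "\<exists>P Q. sides S (path_image \<gamma>) P Q"
proof -
  let ?C = "path_image \<gamma>"
  have hk: "\<And>z. h (k z) = z" "\<And>z. k z \<in> S - E" "\<And>x. x \<in> S - E \<Longrightarrow> k (h x) = x"
    using hom unfolding homeomorphism_def by blast+
  have conth: "continuous_on (S - E) h" and contk: "continuous_on UNIV k"
    using hom unfolding homeomorphism_def by blast+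
  have "path (h \<circ> \<gamma>)"
    using \<gamma> conth by (meson path_continuous_image continuous_on_subset simple_path_imp_path)
  have "inj_on h (path_image \<gamma>)"
    using hk(3) \<gamma>(3) by (metis inj_onI subsetD)
  then have "simple_path (h \<circ> \<gamma>)"
    using \<gamma> conth by (meson simple_path_continuous_image continuous_on_subset)
  moreover have "pathfinish (h \<circ> \<gamma>) = pathstart (h \<circ> \<gamma>)"
    using \<gamma> by (simp add: pathfinish_compose pathstart_compose)
  ultimately obtain inner outer where io: "open inner" "connected inner" "open outer"
      "connected outer" "bounded inner" "inner \<inter> outer = {}"
      "inner \<union> outer = - path_image (h \<circ> \<gamma>)"
      "frontier inner = path_image (h \<circ> \<gamma>)" "frontier outer = path_image (h \<circ> \<gamma>)"
    by (rule Jordan_curve)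
  have im: "path_image (h \<circ> \<gamma>) = h ` ?C"
    by (simp add: path_image_compose)
  have kC: "k ` h ` ?C = ?C"
    using hk(3) \<gamma>(3) by (force simp: image_iff)
  have memC: "h x \<in> h ` ?C \<longleftrightarrow> x \<in> ?C" if "x \<in> S - E" for x
    using kC hk(3)[OF that] by (metis imageI)
  define P where "P = k ` inner"
  define Q where "Q = k ` outer \<union> E"
  have "closed E" "E \<subseteq> S"
    using E by auto
  then have opSE: "openin (top_of_set S) (S - E)"
    by (metis closed_closedin closed_subset openin_diff openin_subtopology_self)
  have opk: "openin (top_of_set S) (k ` W)" if "open W" for W
    using homeomorphism_imp_open_map[OF homeomorphism_symD[OF hom], of W] that opSE
    by (metis open_openin openin_trans subtopology_UNIV)
  have uni: "k ` inner \<union> k ` outer = S - E - ?C"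
  proof -
    have "k ` inner \<union> k ` outer = k ` (- h ` ?C)"
      using io(7) im by (metis image_Un)
    also have "\<dots> = S - E - ?C"
    proof (intro equalityI subsetI)
      fix x assume "x \<in> S - E - ?C"
      then show "x \<in> k ` (- h ` ?C)"
        using memC hk(3) by (metis ComplI DiffD1 DiffD2 imageI)
    next
      fix x assume "x \<in> k ` (- h ` ?C)"
      then obtain z where z: "x = k z" "z \<notin> h ` ?C" by blast
      then show "x \<in> S - E - ?C"
        using hk(1,2) by (metis DiffI imageI)
    qed
    finally show ?thesis .
  qed
  have disj: "k ` inner \<inter> k ` outer = {}"
  proof -
    have "inj k" using hk(1) by (metis injI)
    then show ?thesis using io(6) by (metis image_Int image_empty)
  qed
  have kE: "k ` W \<inter> E = {}" for W
    using hk(2) by (fastforce simp del: hk)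
  have set_eq: "B \<union> Z = X - (Y \<union> A)"
    if "A \<union> B = X - Z - Y" "A \<inter> B = {}" "A \<inter> Z = {}" "Z \<subseteq> X" "Z \<inter> Y = {}" for A B X Y Z :: "'a set"
    using that by blast
  \<comment> \<open>Gain of this form: \<open>?C \<union> P\<close> is the image of the compact
    closure of \<open>inner\<close>, so its complement \<open>Q\<close> is open in \<open>S\<close>
    even at the puncture.\<close>
  have Qeq: "Q = S - (?C \<union> P)"
  proof -
    have "E \<inter> ?C = {}" using \<gamma>(3) by auto
    then show ?thesis
      using set_eq[OF uni disj kE[of inner] \<open>E \<subseteq> S\<close>] unfolding Q_def P_def by blast
  qed
  have "?C \<union> P = k ` (closure inner)"
    using io(8) im kC unfolding P_def closure_Un_frontier by (metis image_Un sup_commute)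
  moreover have "compact (closure inner)"
    using io(5) by simp
  ultimately have "compact (?C \<union> P)"
    using contk by (metis compact_continuous_image continuous_on_subset subset_UNIV)
  then have opQ: "openin (top_of_set S) Q"
    unfolding Qeq by (metis Diff_eq compact_imp_closed open_Compl openin_open_Int)
  \<comment> \<open>The puncture is a limit point of \<open>S\<close> and \<open>Q\<close> is open
    in \<open>S\<close>, so the puncture lies in the closure of the image of \<open>outer\<close>
    under \<open>k\<close>; adding it keeps that image connected.\<close>
  have conQ: "connected Q"
  proof (cases "E = {}")
    case True
    then show ?thesis
      unfolding Q_def using io(4) contk
      by (metis connected_continuous_image continuous_on_subset subset_UNIV sup_bot_right)
  next
    case False
    then obtain p where p: "E = {p}" "p \<in> S" "p islimpt S"
      using E by auto
    obtain T where T: "open T" "Q = S \<inter> T"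
      using opQ unfolding openin_open by auto
    have "p \<in> closure (k ` outer)"
      unfolding closure_iff_nhds_not_empty
    proof (intro allI impI)
      fix A V assume "V \<subseteq> A" "open V" "p \<in> V"
      moreover have "p \<in> T"
        using p T unfolding Q_def by auto
      ultimately obtain y where "y \<in> S" "y \<in> T \<inter> V" "y \<noteq> p"
        using p(3) T(1) unfolding islimpt_def by (metis IntI open_Int)
      then have "y \<in> k ` outer"
        using T(2) p(1) unfolding Q_def by blast
      then show "k ` outer \<inter> A \<noteq> {}"
        using \<open>y \<in> T \<inter> V\<close> \<open>V \<subseteq> A\<close> by auto
    qed
    moreover have "connected (k ` outer)"
      using io(4) contk by (metis connected_continuous_image continuous_on_subset subset_UNIV)
    ultimately show ?thesis
      unfolding Q_def p(1)
      by (metis Un_insert_right closure_subset connected_intermediate_closure insert_subset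
          subset_insertI sup_bot_right)
  qed
  have meet: "U \<inter> k ` W \<noteq> {}"
    if U: "openin (top_of_set S) U" "x \<in> U" and x: "x \<in> ?C" and W: "frontier W = h ` ?C" for U x W
  proof -
    have "openin (top_of_set (S - E)) (U \<inter> (S - E))"
      using U(1) by (metis Diff_subset Int_commute inf.absorb_iff2 openin_subset openin_subtopology_Int2 subtopology_subtopology)
    then have "open (h ` (U \<inter> (S - E)))"
      using homeomorphism_imp_open_map[OF hom] by (metis open_openin subtopology_UNIV)
    moreover have "h x \<in> h ` (U \<inter> (S - E))"
      using U x \<gamma>(3) by blast
    moreover have "h x \<in> closure W"
      using W x unfolding frontier_def by blast
    ultimately have "h ` (U \<inter> (S - E)) \<inter> W \<noteq> {}"
      by (metis closure_iff_nhds_not_empty inf_commute order_refl)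
    then obtain u where "u \<in> U \<inter> (S - E)" "h u \<in> W"
      by auto
    then show ?thesis
      using hk(3) by (metis IntD1 IntD2 IntI empty_iff imageI)
  qed
  have "sides S ?C P Q"
    unfolding sides_def
  proof (intro conjI ballI allI impI)
    show "openin (top_of_set S) P" unfolding P_def by (rule opk[OF io(1)])
    show "openin (top_of_set S) Q" by (rule opQ)
    show "connected P"
      unfolding P_def using io(2) contk
      by (metis connected_continuous_image continuous_on_subset subset_UNIV)
    show "connected Q" by (rule conQ)
    show "P \<inter> Q = {}" unfolding Qeq by auto
    show "P \<union> Q = S - ?C" unfolding Qeq P_def using uni by auto
  next
    fix x U assume "x \<in> ?C" "openin (top_of_set S) U \<and> x \<in> U"
    then show "U \<inter> P \<noteq> {}" "U \<inter> Q \<noteq> {}"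
      unfolding P_def Q_def using meet[of U x] io(8,9) im by blast+
  qed
  then show ?thesis by blast
qed

text \<open>On the sphere the point \<open>x\<close> off the curve serves as the puncture:
  \<open>S - {x}\<close> is homeomorphic to the hyperplane orthogonal to \<open>x\<close>, a copy of
  the complex plane.\<close>

lemma plane_or_sphere_sides:
  fixes S :: "'a::euclidean_space set"
  assumes "(DIM('a) = 2 \<and> S = UNIV) \<or> (DIM('a) = 3 \<and> S = sphere 0 1)"
    and \<gamma>: "simple_path \<gamma>" "pathfinish \<gamma> = pathstart \<gamma>" "path_image \<gamma> \<subseteq> S"
    and x: "x \<in> S" "x \<notin> path_image \<gamma>"
  shows "\<exists>P Q. sides S (path_image \<gamma>) P Q"
  using assms(1)
proof
  assume *: "DIM('a) = 2 \<and> S = UNIV"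
  have "(UNIV :: 'a set) homeomorphic (UNIV :: complex set)"
    by (rule homeomorphic_subspaces) (use * in \<open>auto simp: dim_UNIV\<close>)
  then obtain h :: "'a \<Rightarrow> complex" and k where "homeomorphism (S - {}) UNIV h k"
    using * unfolding homeomorphic_def by auto
  then show ?thesis
    using sides_via_complex_chart \<gamma> by (metis Diff_empty)
next
  assume *: "DIM('a) = 3 \<and> S = sphere 0 1"
  have "norm x = 1"
    using x(1) * by auto
  then have "x \<noteq> 0" by auto
  have "(S - {x}) homeomorphic {y. x \<bullet> y = 0}"
    using homeomorphic_punctured_sphere_hyperplane[of 1 x 0 x 0] x * \<open>x \<noteq> 0\<close> by auto
  moreover have "{y. x \<bullet> y = 0} homeomorphic (UNIV :: complex set)"
    by (rule homeomorphic_subspaces)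
       (use * \<open>x \<noteq> 0\<close> in \<open>auto simp: subspace_hyperplane dim_hyperplane dim_UNIV\<close>)
  ultimately have "(S - {x}) homeomorphic (UNIV :: complex set)"
    by (rule homeomorphic_trans)
  then obtain h :: "'a \<Rightarrow> complex" and k where "homeomorphism (S - {x}) UNIV h k"
    unfolding homeomorphic_def by auto
  \<comment> \<open>A connected set with two points has no isolated point; the antipode
    \<open>- x\<close> is the second point.\<close>
  moreover have "x islimpt S"
  proof (rule connected_imp_perfect)
    show "connected S"
      using * by (simp add: connected_sphere)
    have "- x \<in> S" using x(1) * by auto
    moreover have "- x \<noteq> x" using \<open>x \<noteq> 0\<close> by (simp add: neg_eq_iff_add_eq_0 flip: scaleR_2)
    ultimately show "S \<noteq> {a}" for a using x(1) by (metis singletonD)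
  qed (use x in auto)
  ultimately show ?thesis
    using sides_via_complex_chart[of S "{x}" h k \<gamma>] \<gamma> x by blast
qed

section \<open>Arcs and proper crossings\<close>

definition arc_from :: "'a::topological_space \<Rightarrow> 'a \<Rightarrow> 'a set \<Rightarrow> bool" where
  "arc_from a b K \<longleftrightarrow> (\<exists>g. arc g \<and> path_image g = K \<and> pathstart g = a \<and> pathfinish g = b)"

lemma arc_from_sym: "arc_from a b K \<Longrightarrow> arc_from b a K"
  unfolding arc_from_def
  by (metis arc_reversepath path_image_reversepath pathfinish_reversepath pathstart_reversepath)

lemma arc_from_endpoints:
  assumes "arc_from a b K" shows "a \<in> K" "b \<in> K" "a \<noteq> b"
  using assms unfolding arc_from_def
  by (auto dest: arc_distinct_ends simp: pathstart_in_path_image pathfinish_in_path_image)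

lemma arc_from_connected: "arc_from a b K \<Longrightarrow> connected K"
  unfolding arc_from_def by (auto intro: connected_arc_image)

lemma arc_from_closed:
  fixes K :: "'a::t2_space set"
  shows "arc_from a b K \<Longrightarrow> closed K"
  unfolding arc_from_def by (metis arc_imp_path closed_path_image)

lemma arc_from_minus_start_connected:
  assumes "arc_from a b K"
  shows "connected (K - {a})"
proof -
  obtain g where g: "arc g" "path_image g = K" "pathstart g = a"
    using assms unfolding arc_from_def by blast
  have inj: "inj_on g {0..1}" and cont: "continuous_on {0..1} g"
    using g(1) by (auto simp: arc_def path_def)
  have "K - {a} = g ` {0<..1}"
  proof -
    have "{0<..1} = {0..1} - {0::real}" by auto
    then have "g ` {0<..1} = g ` {0..1} - g ` {0}"
      using inj by (simp add: inj_on_image_set_diff[of g "{0..1}"])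
    then show ?thesis
      using g by (simp add: path_image_def pathstart_def)
  qed
  moreover have "connected (g ` {0<..1})"
    using cont by (intro connected_continuous_image) (auto elim: continuous_on_subset)
  ultimately show ?thesis by simp
qed

lemma arc_from_minus_end_connected: "arc_from a b K \<Longrightarrow> connected (K - {b})"
  using arc_from_minus_start_connected arc_from_sym by blast

lemma arc_split_at:
  fixes g :: "real \<Rightarrow> 'a::real_normed_vector"
  assumes "arc g" "0 < t" "t < 1"
  shows "arc_from (pathstart g) (g t) (g ` {0..t})" "arc_from (g t) (pathfinish g) (g ` {t..1})"
    "g ` {0..t} \<union> g ` {t..1} = path_image g" "g ` {0..t} \<inter> g ` {t..1} = {g t}"
proof -
  have inj: "inj_on g {0..1}"
    using assms(1) by (simp add: arc_def)
  show "arc_from (pathstart g) (g t) (g ` {0..t})"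
    unfolding arc_from_def
    by (rule exI[of _ "subpath 0 t g"])
       (use assms in \<open>simp add: arc_subpath_arc path_image_subpath pathstart_subpath pathfinish_subpath pathstart_def[of g]\<close>)
  show "arc_from (g t) (pathfinish g) (g ` {t..1})"
    unfolding arc_from_def
    by (rule exI[of _ "subpath t 1 g"])
       (use assms in \<open>simp add: arc_subpath_arc path_image_subpath pathstart_subpath pathfinish_subpath pathfinish_def[of g]\<close>)
  show "g ` {0..t} \<union> g ` {t..1} = path_image g"
    unfolding path_image_def image_Un[symmetric] using assms by (intro arg_cong[of _ _ "(`) g"]) auto
  have "g ` {0..t} \<inter> g ` {t..1} = g ` ({0..t} \<inter> {t..1})"
    using inj assms by (intro inj_on_image_Int[symmetric, of g "{0..1}"]) auto
  then show "g ` {0..t} \<inter> g ` {t..1} = {g t}"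
    using assms by simp
qed

lemma arc_from_split:
  fixes K :: "'a::real_normed_vector set"
  assumes "arc_from a b K" "x \<in> K" "x \<noteq> a" "x \<noteq> b"
  obtains K1 K2 where "arc_from a x K1" "arc_from x b K2" "K1 \<union> K2 = K" "K1 \<inter> K2 = {x}"
proof -
  obtain g where g: "arc g" "path_image g = K" "pathstart g = a" "pathfinish g = b"
    using assms(1) unfolding arc_from_def by blast
  then obtain t where t: "t \<in> {0..1}" "x = g t"
    using assms(2) unfolding path_image_def by blast
  with assms(3,4) g have "0 < t" "t < 1"
    unfolding pathstart_def pathfinish_def by (auto simp: less_le)
  from arc_split_at[OF g(1) this] show thesis
    using that g t by auto
qed

text \<open>The parameters that are mapped into the closed set \<open>H\<close> form a compact set,
  whose least element gives \<open>x\<close>. The last conclusion later handles edges that meet the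
  arc only at its far end.\<close>

lemma arc_from_first_hit:
  fixes K :: "'a::real_normed_vector set"
  assumes "arc_from a b K" "closed H" "a \<notin> H" "K \<inter> H \<noteq> {}"
  obtains x K1 where "arc_from a x K1" "K1 \<subseteq> K" "K1 \<inter> H = {x}" "b \<in> K1 \<Longrightarrow> x = b"
proof -
  obtain g where g: "arc g" "path_image g = K" "pathstart g = a" "pathfinish g = b"
    using assms(1) unfolding arc_from_def by blast
  have cont: "continuous_on {0..1} g" and inj: "inj_on g {0..1}"
    using g(1) by (auto simp: arc_def path_def)
  define T where "T = {0..1} \<inter> g -` H"
  have "closed T"
    unfolding T_def using cont assms(2) by (simp add: continuous_closed_preimage)
  then have "compact T"
    unfolding T_def by (metis bounded_Int bounded_closed_interval box_real(2) compact_eq_bounded_closed)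
  moreover have "T \<noteq> {}"
    using assms(4) g(2) unfolding T_def path_image_def by blast
  ultimately obtain t where t: "t \<in> T" "\<And>s. s \<in> T \<Longrightarrow> t \<le> s"
    using compact_attains_inf by metis
  have "t \<noteq> 0"
    using t(1) assms(3) g(3) unfolding T_def pathstart_def by auto
  then have t01: "0 < t" "t \<le> 1"
    using t(1) unfolding T_def by auto
  have 1: "arc_from a (g t) (g ` {0..t})"
    unfolding arc_from_def
    by (rule exI[of _ "subpath 0 t g"])
       (use g t01 in \<open>simp add: arc_subpath_arc path_image_subpath pathstart_subpath pathfinish_subpath pathstart_def[of g]\<close>)
  have 2: "g ` {0..t} \<subseteq> K"
    using g(2) t01 unfolding path_image_def by auto
  have 3: "g ` {0..t} \<inter> H = {g t}"
  proof -
    have "s = t" if "s \<in> {0..t}" "g s \<in> H" for s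
      using t(2)[of s] that t01 unfolding T_def by force
    then show ?thesis
      using t(1) t01 unfolding T_def by (auto intro!: arg_cong[of _ t g])
  qed
  have 4: "g t = b" if b: "b \<in> g ` {0..t}"
  proof -
    obtain s where s: "s \<in> {0..t}" "g s = g 1"
      using b g(4) unfolding pathfinish_def by auto
    then have "s = 1"
      using inj t01 unfolding inj_on_def by auto
    then show ?thesis
      using s t01 g(4) unfolding pathfinish_def by auto
  qed
  show thesis
    using that[OF 1 2 3] 4 by blast
qed

lemma closed_curve_of_three_arcs:
  assumes "arc_from a b K1" "arc_from b c K2" "arc_from c a K3"
    "K1 \<inter> K2 = {b}" "K2 \<inter> K3 = {c}" "K3 \<inter> K1 = {a}"
  obtains \<gamma> where "simple_path \<gamma>" "pathfinish \<gamma> = pathstart \<gamma>" "path_image \<gamma> = K1 \<union> K2 \<union> K3"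
proof -
  obtain g1 g2 g3 where g: "arc g1" "path_image g1 = K1" "pathstart g1 = a" "pathfinish g1 = b"
    "arc g2" "path_image g2 = K2" "pathstart g2 = b" "pathfinish g2 = c"
    "arc g3" "path_image g3 = K3" "pathstart g3 = c" "pathfinish g3 = a"
    using assms(1-3) unfolding arc_from_def by metis
  show thesis
  proof (rule that)
    show "simple_path (g1 +++ g2 +++ g3)"
      by (rule simple_path_join3I) (use g assms(4-6) in auto)
    show "pathfinish (g1 +++ g2 +++ g3) = pathstart (g1 +++ g2 +++ g3)"
      using g by simp
    show "path_image (g1 +++ g2 +++ g3) = K1 \<union> K2 \<union> K3"
      using g by (simp add: path_image_join Un_assoc)
  qed
qed

section \<open>Local behaviour at a proper crossing\<close>

lemma proper_crossing_mem:
  assumes "proper_crossing S A B x"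
  shows "x \<in> A" "x \<in> B"
proof -
  obtain U and h :: "'a \<Rightarrow> complex" and k where U: "x \<in> U"
    "homeomorphism U (ball 0 1) h k" "h x = 0"
    "h ` (A \<inter> U) = {z \<in> ball 0 1. Im z = 0}" "h ` (B \<inter> U) = {z \<in> ball 0 1. Re z = 0}"
    using assms unfolding proper_crossing_def by blast
  have k: "\<And>y. y \<in> U \<Longrightarrow> k (h y) = y"
    using U(2) unfolding homeomorphism_def by blast
  have "0 \<in> h ` (A \<inter> U)" "0 \<in> h ` (B \<inter> U)"
    unfolding U(4,5) by auto
  then show "x \<in> A" "x \<in> B"
    using k U(1,3) by (metis IntE imageE)+
qed

text \<open>In the chart, the real axis cuts a small disc about 0 into two half discs, and the
  imaginary axis enters both. Pulled back by \<open>k\<close>, the half discs become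
  \<open>H1\<close> and \<open>H2\<close>.\<close>

lemma proper_crossing_local:
  fixes S :: "'a::euclidean_space set"
  assumes "proper_crossing S A B x" "open W" "x \<in> W"
  obtains N H1 H2 where "openin (top_of_set S) N" "x \<in> N" "N \<subseteq> W"
    "connected H1" "connected H2" "N - A = H1 \<union> H2" "H1 \<inter> B \<noteq> {}" "H2 \<inter> B \<noteq> {}"
proof -
  obtain U and h :: "'a \<Rightarrow> complex" and k where U: "openin (top_of_set S) U" "x \<in> U"
    and hom: "homeomorphism U (ball 0 1) h k" and hx: "h x = 0"
    and hA: "h ` (A \<inter> U) = {z \<in> ball 0 1. Im z = 0}"
    and hB: "h ` (B \<inter> U) = {z \<in> ball 0 1. Re z = 0}"
    using assms(1) unfolding proper_crossing_def by blast
  have kU: "\<And>z. z \<in> ball 0 1 \<Longrightarrow> k z \<in> U" and hk: "\<And>z. z \<in> ball 0 1 \<Longrightarrow> h (k z) = z"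
    and kh: "\<And>y. y \<in> U \<Longrightarrow> k (h y) = y" and hb: "\<And>y. y \<in> U \<Longrightarrow> h y \<in> ball 0 1"
    and contk: "continuous_on (ball 0 1) k"
    using hom unfolding homeomorphism_def by blast+
  have kA: "k z \<in> A \<longleftrightarrow> Im z = 0" and kB: "k z \<in> B \<longleftrightarrow> Re z = 0" if z: "z \<in> ball 0 1" for z
  proof -
    have *: "k z \<in> C \<longleftrightarrow> z \<in> h ` (C \<inter> U)" for C
    proof
      assume "k z \<in> C"
      then show "z \<in> h ` (C \<inter> U)" using kU[OF z] hk[OF z] by (metis IntI imageI)
    next
      assume "z \<in> h ` (C \<inter> U)"
      then show "k z \<in> C" using kh by (metis IntE imageE)
    qed
    show "k z \<in> A \<longleftrightarrow> Im z = 0" "k z \<in> B \<longleftrightarrow> Re z = 0"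
      using *[of A] *[of B] hA hB z by simp_all
  qed
  have "openin (top_of_set U) (U \<inter> W)"
    using assms(2) by (simp add: openin_open_Int)
  then have "openin (top_of_set (ball 0 1)) (h ` (U \<inter> W))"
    by (rule homeomorphism_imp_open_map[OF hom])
  then have "open (h ` (U \<inter> W))"
    by (metis open_ball openin_open_trans)
  moreover have "0 \<in> h ` (U \<inter> W)"
    using U(2) assms(3) hx by (metis IntI imageI)
  ultimately obtain r where r: "0 < r" "ball 0 r \<subseteq> h ` (U \<inter> W)"
    using open_contains_ball by metis
  moreover have "h ` (U \<inter> W) \<subseteq> ball 0 1"
    using hb by blast
  ultimately have r1: "ball 0 r \<subseteq> (ball 0 1 :: complex set)" by blast
  define N where "N = k ` ball 0 r"
  define H1 where "H1 = k ` (ball 0 r \<inter> {z. 0 < Im z})"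
  define H2 where "H2 = k ` (ball 0 r \<inter> {z. Im z < 0})"
  show thesis
  proof
    have "openin (top_of_set (ball 0 1)) (ball 0 r :: complex set)"
      using r1 by (simp add: open_openin_trans)
    then have "openin (top_of_set U) N"
      unfolding N_def by (rule homeomorphism_imp_open_map[OF homeomorphism_symD[OF hom]])
    then show "openin (top_of_set S) N"
      using U(1) openin_trans by blast
    have "k 0 = x" using kh[OF U(2)] hx by simp
    then show "x \<in> N"
      unfolding N_def using r(1) by (metis centre_in_ball imageI)
    show "N \<subseteq> W"
      unfolding N_def using r(2) kh by (smt (verit, best) IntE image_iff image_subset_iff subsetD)
    have "connected (k ` Z)" if "convex Z" "Z \<subseteq> ball 0 r" for Z
      using that contk r1 by (meson connected_continuous_image continuous_on_subset convex_connected order_trans)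
    then show "connected H1" "connected H2"
      unfolding H1_def H2_def
      by (auto simp: convex_Int convex_halfspace_Im_gt convex_halfspace_Im_lt)
    show "N - A = H1 \<union> H2"
    proof (intro equalityI subsetI)
      fix y assume "y \<in> N - A"
      then obtain z where "z \<in> ball 0 r" "y = k z" "Im z \<noteq> 0"
        unfolding N_def using kA r1 by blast
      then show "y \<in> H1 \<union> H2"
        unfolding H1_def H2_def by (cases "Im z > 0") auto
    next
      fix y assume "y \<in> H1 \<union> H2"
      then obtain z where "z \<in> ball 0 r" "y = k z" "Im z \<noteq> 0"
        unfolding H1_def H2_def by auto
      then show "y \<in> N - A"
        unfolding N_def using kA r1 by blast
    qed
    have "Complex 0 (r/2) \<in> ball 0 r \<inter> {z. 0 < Im z}" "Complex 0 (- r/2) \<in> ball 0 r \<inter> {z. Im z < 0}"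
      using r(1) by (auto simp: cmod_def)
    moreover from this have "k (Complex 0 (r/2)) \<in> B" "k (Complex 0 (- r/2)) \<in> B"
      using kB r1 by auto
    ultimately show "H1 \<inter> B \<noteq> {}" "H2 \<inter> B \<noteq> {}"
      unfolding H1_def H2_def by blast+
  qed
qed

text \<open>The two half discs at \<open>x\<close> lie on different sides of \<open>C\<close>,
  because both sides accumulate at \<open>x\<close>. So the arc reaches both sides, while each half
  of it, being connected and off \<open>C\<close>, stays on one. The crossing is required only with
  a set \<open>A\<close> that agrees with \<open>C\<close> near \<open>x\<close>, since
  \<open>C\<close> may be pieced together from several arcs.\<close>

lemma proper_crossing_changes_side:
  fixes S :: "'a::euclidean_space set"
  assumes sides: "sides S C P Q"
    and cross: "proper_crossing S A K x" and W: "open W" "x \<in> W" "C \<inter> W = A \<inter> W"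
    and K: "arc_from a b K" "K \<subseteq> S" "K \<inter> C = {x}"
    and ab: "x \<noteq> a" "x \<noteq> b"
  shows "a \<in> P \<longleftrightarrow> b \<in> Q"
proof -
  obtain N H1 H2 where N: "openin (top_of_set S) N" "x \<in> N" "N \<subseteq> W"
    and H: "connected H1" "connected H2" "N - A = H1 \<union> H2" "H1 \<inter> K \<noteq> {}" "H2 \<inter> K \<noteq> {}"
    using proper_crossing_local[OF cross W(1,2)] .
  have "N \<subseteq> S" using N(1) openin_imp_subset by blast
  have PQ: "P \<inter> Q = {}" "P \<union> Q = S - C"
    using sides_disjoint[OF sides] sides_union[OF sides] .
  have NC: "N - C = H1 \<union> H2"
    using H(3) N(3) W(3) by blast
  have "x \<in> C" using K(3) by blast
  from sides_frontier[OF sides N(1) this N(2)] have "N \<inter> P \<noteq> {}" "N \<inter> Q \<noteq> {}" .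
  then have "(H1 \<union> H2) \<inter> P \<noteq> {}" "(H1 \<union> H2) \<inter> Q \<noteq> {}"
    using NC PQ by blast+
  moreover have "H1 \<subseteq> P \<or> H1 \<subseteq> Q" "H2 \<subseteq> P \<or> H2 \<subseteq> Q"
    using sides_connected_subset[OF sides] H(1,2) NC \<open>N \<subseteq> S\<close> by blast+
  ultimately have hits: "K \<inter> P \<noteq> {}" "K \<inter> Q \<noteq> {}"
    using H(4,5) PQ(1) by blast+
  have "x \<in> K" using K(3) by blast
  then obtain K1 K2 where K12: "arc_from a x K1" "arc_from x b K2" "K1 \<union> K2 = K" "K1 \<inter> K2 = {x}"
    using arc_from_split[OF K(1)] ab by metis
  have "K1 - {x} \<subseteq> P \<or> K1 - {x} \<subseteq> Q"
    by (rule sides_connected_subset[OF sides arc_from_minus_end_connected[OF K12(1)]])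
       (use K K12(3) in auto)
  moreover have "K2 - {x} \<subseteq> P \<or> K2 - {x} \<subseteq> Q"
    by (rule sides_connected_subset[OF sides arc_from_minus_start_connected[OF K12(2)]])
       (use K K12(3) in auto)
  moreover have "a \<in> K1 - {x}" "b \<in> K2 - {x}"
    using arc_from_endpoints K12(1,2) ab by blast+
  moreover have "x \<notin> P" "x \<notin> Q"
    using \<open>x \<in> C\<close> PQ(2) by blast+
  ultimately show ?thesis
    using hits PQ(1) K12(3) by blast
qed

text \<open>An arc leaves its end \<open>x\<close> in one direction only: in the chart its initial
  piece stays in one half of a diameter, and the rest of the arc keeps a distance from
  \<open>x\<close>. A proper crossing would put the whole diameter on the arc.\<close>

lemma not_proper_crossing_at_endpoint:
  fixes S :: "'a::euclidean_space set"
  assumes "arc_from x b K" "K \<subseteq> S"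
  shows "\<not> proper_crossing S A K x"
proof
  assume "proper_crossing S A K x"
  then obtain U and h :: "'a \<Rightarrow> complex" and k where U: "openin (top_of_set S) U" "x \<in> U"
    and hom: "homeomorphism U (ball 0 1) h k" and hx: "h x = 0"
    and hK: "h ` (K \<inter> U) = {z \<in> ball 0 1. Re z = 0}"
    unfolding proper_crossing_def by blast
  have kU: "\<And>z. z \<in> ball 0 1 \<Longrightarrow> k z \<in> U" and hk: "\<And>z. z \<in> ball 0 1 \<Longrightarrow> h (k z) = z"
    and kh: "\<And>y. y \<in> U \<Longrightarrow> k (h y) = y"
    and contk: "continuous_on (ball 0 1) k" and conth: "continuous_on U h"
    using hom unfolding homeomorphism_def by blast+
  obtain g where g: "arc g" "path_image g = K" "g 0 = x"
    using assms(1) unfolding arc_from_def pathstart_def by blast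
  have cont: "continuous_on {0..1} g" and inj: "inj_on g {0..1}"
    using g(1) by (auto simp: arc_def path_def)
  obtain T where T: "open T" "U = S \<inter> T"
    using U(1) unfolding openin_open by auto
  obtain r where r: "r > 0" "ball x r \<subseteq> T"
    using T U(2) open_contains_ball by (metis IntD2)
  obtain d where d: "d > 0" "\<And>t. t \<in> {0..1} \<Longrightarrow> dist t 0 < d \<Longrightarrow> dist (g t) (g 0) < r"
    using cont r(1) unfolding continuous_on_iff by (metis atLeastAtMost_iff order_refl zero_le_one)
  define e where "e = min (d/2) 1"
  have e: "0 < e" "e \<le> 1" "e < d"
    using d(1) unfolding e_def by auto
  have gU: "g t \<in> K \<inter> U" if "t \<in> {0..e}" for t
  proof -
    have "g t \<in> ball x r"
      using d(2)[of t] that e g(3) by (auto simp: dist_commute)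
    moreover have "g t \<in> K"
      using that e g(2) unfolding path_image_def by auto
    ultimately show ?thesis
      using r(2) T(2) assms(2) by blast
  qed
  \<comment> \<open>On \<open>K \<inter> U\<close> the real part of \<open>h\<close> is 0, so
    \<open>\<psi>\<close> is the position along the diameter. By injectivity it vanishes only at
    \<open>t = 0\<close>, hence it keeps one sign on the rest of \<open>{0..e}\<close> by the
    intermediate value theorem.\<close>
  define \<psi> where "\<psi> t = Im (h (g t))" for t
  have cont\<psi>: "continuous_on {0..e} \<psi>"
    unfolding \<psi>_def using e gU
    by (intro continuous_intros continuous_on_compose2[OF conth] continuous_on_subset[OF cont]) auto
  have nz: "\<psi> t \<noteq> 0" if "t \<in> {0<..e}" for t
  proof
    assume "\<psi> t = 0"
    moreover have "Re (h (g t)) = 0"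
      using gU[of t] that hK by force
    ultimately have "h (g t) = h x"
      unfolding \<psi>_def hx by (simp add: complex_eq_iff)
    then have "g t = g 0"
      using kh gU[of t] that U(2) g(3) by (metis IntD2 atLeastAtMost_iff greaterThanAtMost_iff less_imp_le)
    then show False
      using inj that e unfolding inj_on_def by force
  qed
  have sgn: "\<psi> t * \<psi> e > 0" if t: "t \<in> {0<..e}" for t
  proof (rule ccontr)
    assume "\<not> \<psi> t * \<psi> e > 0"
    then have *: "\<psi> t \<le> 0 \<and> 0 \<le> \<psi> e \<or> \<psi> e \<le> 0 \<and> 0 \<le> \<psi> t"
      unfolding zero_less_mult_iff by linarith
    have te: "t \<le> e" and c: "continuous_on {t..e} \<psi>"
      using t by (auto intro: continuous_on_subset[OF cont\<psi>])
    obtain s where "s \<ge> t" "s \<le> e" "\<psi> s = 0"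
      using * IVT'[of \<psi> t 0 e, OF _ _ te c] IVT2'[of \<psi> e 0 t, OF _ _ te c] by blast
    then show False using nz[of s] t by auto
  qed
  have "compact (g ` {e..1})"
    using cont e by (intro compact_continuous_image) (auto elim: continuous_on_subset)
  then have "open (- g ` {e..1})"
    by (simp add: compact_imp_closed open_Compl)
  moreover have "x \<in> - g ` {e..1}"
    using inj e g(3) unfolding inj_on_def by force
  ultimately obtain r' where r': "r' > 0" "ball x r' \<subseteq> - g ` {e..1}"
    using open_contains_ball by metis
  have k0: "k 0 = x"
    using kh[OF U(2)] hx by simp
  obtain d' where d': "d' > 0" "\<And>z. z \<in> ball 0 1 \<Longrightarrow> dist z 0 < d' \<Longrightarrow> dist (k z) (k 0) < r'"
    using contk r'(1) unfolding continuous_on_iff by (metis centre_in_ball zero_less_one)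
  define s where "s = min d' 1 / 2"
  have s: "0 < s" "s < d'" "s < 1"
    using d'(1) unfolding s_def by auto
  \<comment> \<open>A point of the diameter in the half opposite to \<open>g e\<close>, so near 0
    that \<open>k z\<close> avoids the part of the arc from \<open>e\<close> on. Its parameter is
    then below \<open>e\<close>, and its sign contradicts that of \<open>\<psi> e\<close>.\<close>
  define z where "z = Complex 0 (- s * sgn (\<psi> e))"
  have "\<psi> e \<noteq> 0" using nz[of e] e by auto
  then have "norm z = s"
    unfolding z_def using s by (auto simp: cmod_def abs_mult sgn_if)
  then have z: "z \<in> ball 0 1" "dist z 0 < d'" "z \<noteq> 0"
    using s by auto
  then have "z \<in> h ` (K \<inter> U)"
    unfolding hK z_def by auto
  then have "k z \<in> K"
    using kh by (metis IntE imageE)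
  then obtain t where t: "t \<in> {0..1}" "k z = g t"
    using g(2) unfolding path_image_def by auto
  have "k z \<notin> g ` {e..1}"
  proof -
    have "k z \<in> ball x r'"
      using d'(2)[OF z(1,2)] k0 by (simp add: dist_commute)
    then show ?thesis using r'(2) by blast
  qed
  then have "t < e" using t by force
  moreover have "t \<noteq> 0"
    using t(2) g(3) hx hk[OF z(1)] z(3) by metis
  ultimately have pos: "\<psi> t * \<psi> e > 0" using sgn t(1) by auto
  have "\<psi> t = - s * sgn (\<psi> e)"
    unfolding \<psi>_def[of t] t(2)[symmetric] hk[OF z(1)] by (simp add: z_def)
  then have "\<psi> t * \<psi> e = - (s * (sgn (\<psi> e) * \<psi> e))"
    by simp
  moreover have "s * (sgn (\<psi> e) * \<psi> e) \<ge> 0"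
  proof (rule mult_nonneg_nonneg)
    show "sgn (\<psi> e) * \<psi> e \<ge> 0" by (simp add: sgn_if)
  qed (use s(1) in simp)
  ultimately show False using pos by linarith
qed

section \<open>Complete separable drawings\<close>

locale separable_complete_drawing =
  fixes S :: "'a::euclidean_space set"
    and D :: "('v, 'a) drawing"
  assumes plane_or_sphere: "(DIM('a) = 2 \<and> S = UNIV) \<or> (DIM('a) = 3 \<and> S = sphere 0 1)"
    and complete: "edges D = all_edges (verts D)"
    and separable: "separable_drawing S D"
begin

abbreviation V :: "'v set" where "V \<equiv> verts D"
abbreviation pt :: "'v \<Rightarrow> 'a" where "pt \<equiv> place D"
abbreviation seg :: "'v \<Rightarrow> 'v \<Rightarrow> 'a set" where "seg a b \<equiv> edge_image D {a, b}"

text \<open>A combinatorial stand-in for \<open>proper_crossing\<close>: by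
  \<open>crossing_point\<close> and \<open>not_proper_crossing\<close>, two distinct edges of the
  drawing cross properly exactly when they have no common vertex and their images meet.\<close>

definition cross :: "'v set \<Rightarrow> 'v set \<Rightarrow> bool" where
  "cross e f \<longleftrightarrow> e \<inter> f = {} \<and> edge_image D e \<inter> edge_image D f \<noteq> {}"

lemma cross_sym: "cross e f \<Longrightarrow> cross f e"
  unfolding cross_def by blast

section \<open>Vertices, edges and their intersections\<close>

lemma simple: "simple_drawing S D"
  using separable unfolding separable_drawing_def by blast

lemma finite_V: "finite V"
  using simple unfolding simple_drawing_def by blast

lemma edge_mem: "{a, b} \<in> edges D \<longleftrightarrow> a \<in> V \<and> b \<in> V \<and> a \<noteq> b"
  unfolding complete all_edges_def by (auto simp: card_insert_if)

lemma edgeE: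
  assumes "f \<in> edges D"
  obtains a b where "f = {a, b}" "a \<in> V" "b \<in> V" "a \<noteq> b"
  using assms unfolding complete all_edges_def by (auto simp: card_2_iff)

lemma pt_eq_iff: "a \<in> V \<Longrightarrow> b \<in> V \<Longrightarrow> pt a = pt b \<longleftrightarrow> a = b"
  using simple unfolding simple_drawing_def by (meson inj_on_eq_iff)

lemma pt_in_S: "a \<in> V \<Longrightarrow> pt a \<in> S"
  using simple unfolding simple_drawing_def by blast

lemma edge_image_subset: "e \<in> edges D \<Longrightarrow> edge_image D e \<subseteq> S"
  using simple unfolding simple_drawing_def by blast

lemma pt_in_edge_image:
  assumes "e \<in> edges D" "c \<in> V"
  shows "pt c \<in> edge_image D e \<longleftrightarrow> c \<in> e"
proof -
  have "e \<subseteq> V" using assms(1) unfolding complete all_edges_def by blast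
  have "edge_image D e \<inter> pt ` V = pt ` e"
    using simple assms(1) unfolding simple_drawing_def by blast
  then have "pt c \<in> edge_image D e \<longleftrightarrow> pt c \<in> pt ` e"
    using assms(2) by blast
  then show ?thesis
    using pt_eq_iff assms(2) \<open>e \<subseteq> V\<close> by (auto simp: image_iff)
qed

lemma pt_in_seg: "a \<in> V \<Longrightarrow> b \<in> V \<Longrightarrow> a \<noteq> b \<Longrightarrow> c \<in> V \<Longrightarrow> pt c \<in> seg a b \<longleftrightarrow> c = a \<or> c = b"
  using pt_in_edge_image[of "{a, b}" c] edge_mem by auto

lemma seg_subset: "a \<in> V \<Longrightarrow> b \<in> V \<Longrightarrow> a \<noteq> b \<Longrightarrow> seg a b \<subseteq> S"
  using edge_image_subset edge_mem by blast

lemma seg_arc: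
  assumes "a \<in> V" "b \<in> V" "a \<noteq> b"
  shows "arc_from (pt a) (pt b) (seg a b)"
proof -
  have e: "{a, b} \<in> edges D" using assms edge_mem by blast
  let ?g = "curve D {a, b}"
  have "arc ?g" "{pathstart ?g, pathfinish ?g} = pt ` {a, b}"
    using simple e unfolding simple_drawing_def by blast+
  then have *: "arc_from (pathstart ?g) (pathfinish ?g) (seg a b)"
    and "pathstart ?g = pt a \<and> pathfinish ?g = pt b \<or> pathstart ?g = pt b \<and> pathfinish ?g = pt a"
    unfolding arc_from_def by (auto simp: doubleton_eq_iff)
  then show ?thesis
    using arc_from_sym by metis
qed

lemma edge_images_meet:
  assumes "e \<in> edges D" "f \<in> edges D" "e \<noteq> f" "edge_image D e \<inter> edge_image D f \<noteq> {}"
  obtains x where "edge_image D e \<inter> edge_image D f = {x}"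
    "x \<in> pt ` (e \<inter> f) \<or> proper_crossing S (edge_image D e) (edge_image D f) x"
  using simple assms unfolding simple_drawing_def by metis

lemma edge_images_adjacent:
  assumes "e \<in> edges D" "f \<in> edges D" "e \<noteq> f" "a \<in> e" "a \<in> f"
  shows "edge_image D e \<inter> edge_image D f = {pt a}"
proof -
  have "a \<in> V"
    using assms(1,4) unfolding complete all_edges_def by blast
  then have "pt a \<in> edge_image D e \<inter> edge_image D f"
    using assms pt_in_edge_image by blast
  then show ?thesis
    using edge_images_meet[OF assms(1-3)] by (metis empty_iff singletonD)
qed

lemma seg_adjacent:
  assumes "a \<in> V" "b \<in> V" "c \<in> V" "a \<noteq> b" "a \<noteq> c" "b \<noteq> c"
  shows "seg a b \<inter> seg a c = {pt a}"
  using edge_images_adjacent[of "{a, b}" "{a, c}" a] assms edge_mem by (auto simp: doubleton_eq_iff)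

lemma crossing_point:
  assumes "e \<in> edges D" "f \<in> edges D" "cross e f"
  obtains x where "edge_image D e \<inter> edge_image D f = {x}"
    "proper_crossing S (edge_image D e) (edge_image D f) x" "x \<notin> pt ` V"
proof -
  have "e \<noteq> {}"
    using assms(1) unfolding complete all_edges_def by auto
  then have "e \<noteq> f"
    using assms(3) unfolding cross_def by auto
  then obtain x where x: "edge_image D e \<inter> edge_image D f = {x}"
    "x \<in> pt ` (e \<inter> f) \<or> proper_crossing S (edge_image D e) (edge_image D f) x"
    using edge_images_meet[OF assms(1,2)] assms(3) unfolding cross_def by metis
  moreover have "x \<notin> pt ` V"
  proof
    assume "x \<in> pt ` V"
    then obtain u where "u \<in> V" "x = pt u" by blast
    then have "u \<in> e" "u \<in> f"
      using x(1) pt_in_edge_image assms(1,2) by blast+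
    then show False
      using assms(3) unfolding cross_def by blast
  qed
  ultimately show thesis
    using that assms(3) unfolding cross_def by auto
qed

text \<open>Edges that meet without \<open>cross\<close> share a vertex, which is then their only
  common point and an end of both arcs; no proper crossing occurs at an end of an arc. This turns
  the combinatorial result into \<open>crossing_free\<close>.\<close>

lemma not_proper_crossing:
  assumes "e \<in> edges D" "f \<in> edges D" "e \<noteq> f" "\<not> cross e f"
  shows "\<not> proper_crossing S (edge_image D e) (edge_image D f) x"
proof
  assume *: "proper_crossing S (edge_image D e) (edge_image D f) x"
  then have x: "x \<in> edge_image D e \<inter> edge_image D f"
    using proper_crossing_mem by blast
  then obtain a where a: "a \<in> e" "a \<in> f"
    using assms(4) unfolding cross_def by blast
  then have "x = pt a"
    using edge_images_adjacent[OF assms(1-3)] x by blast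
  moreover obtain b where "f = {a, b}" "a \<in> V" "b \<in> V" "a \<noteq> b"
  proof -
    obtain c d where "f = {c, d}" "c \<in> V" "d \<in> V" "c \<noteq> d"
      using edgeE[OF assms(2)] .
    then show ?thesis
      using a(2) that[of d] that[of c] by (auto simp: insert_commute)
  qed
  ultimately show False
    using not_proper_crossing_at_endpoint[OF seg_arc seg_subset, of a b] * by blast
qed

section \<open>Separator curves and the sides of edges\<close>

lemma closed_curve_sides:
  assumes "simple_path \<gamma>" "pathfinish \<gamma> = pathstart \<gamma>" "path_image \<gamma> \<subseteq> S"
    "x \<in> S" "x \<notin> path_image \<gamma>"
  obtains P Q where "sides S (path_image \<gamma>) P Q"
  using plane_or_sphere_sides[OF plane_or_sphere assms] by blast

definition separator :: "'v \<Rightarrow> 'v \<Rightarrow> 'a set \<Rightarrow> 'a set \<Rightarrow> 'a set \<Rightarrow> bool" where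
  "separator a b C P Q \<longleftrightarrow>
     sides S C P Q \<and> C \<subseteq> S \<and> seg a b \<subseteq> C \<and> C \<inter> pt ` V = pt ` {a, b} \<and>
     (\<forall>f\<in>edges D. f \<noteq> {a, b} \<longrightarrow> C \<inter> edge_image D f = {} \<or>
        (\<exists>x. C \<inter> edge_image D f = {x} \<and> (proper_crossing S C (edge_image D f) x \<or> x \<in> pt ` f)))"

lemma separatorD:
  assumes "separator a b C P Q"
  shows "sides S C P Q" "C \<subseteq> S" "seg a b \<subseteq> C" "C \<inter> pt ` V = pt ` {a, b}"
    "P \<inter> Q = {}" "P \<union> Q = S - C"
proof -
  note * = assms[unfolded separator_def]
  show s: "sides S C P Q" using * by (elim conjE)
  show "C \<subseteq> S" using * by (elim conjE)
  show "seg a b \<subseteq> C" using * by (elim conjE)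
  show "C \<inter> pt ` V = pt ` {a, b}" using * by (elim conjE)
  show "P \<inter> Q = {}" "P \<union> Q = S - C"
    using sides_disjoint[OF s] sides_union[OF s] .
qed

lemma separator_edge_meet:
  assumes "separator a b C P Q" "f \<in> edges D" "f \<noteq> {a, b}" "C \<inter> edge_image D f \<noteq> {}"
  obtains x where "C \<inter> edge_image D f = {x}" "proper_crossing S C (edge_image D f) x \<or> x \<in> pt ` f"
  using assms unfolding separator_def by metis

lemma separator_sym: "separator a b C P Q \<Longrightarrow> separator a b C Q P"
  unfolding separator_def using sides_sym by metis

lemma separator_exists:
  assumes "a \<in> V" "b \<in> V" "a \<noteq> b" "c \<in> V" "c \<noteq> a" "c \<noteq> b"
  obtains C P Q where "separator a b C P Q" "pt c \<in> Q"
proof -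
  have "separator_edge S D {a, b}"
    using separable assms edge_mem unfolding separable_drawing_def by blast
  then obtain \<gamma> where \<gamma>: "simple_path \<gamma>" "pathfinish \<gamma> = pathstart \<gamma>" "path_image \<gamma> \<subseteq> S"
    "seg a b \<subseteq> path_image \<gamma>" "path_image \<gamma> \<inter> pt ` V = pt ` {a, b}"
    "\<forall>f\<in>edges D. f \<noteq> {a, b} \<longrightarrow> path_image \<gamma> \<inter> edge_image D f = {} \<or>
        (\<exists>x. path_image \<gamma> \<inter> edge_image D f = {x} \<and>
          (proper_crossing S (path_image \<gamma>) (edge_image D f) x \<or> x \<in> pt ` f))"
    unfolding separator_edge_def by blast
  have "pt c \<notin> pt ` {a, b}"
    using assms pt_eq_iff by auto
  then have c: "pt c \<notin> path_image \<gamma>"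
    using \<gamma>(5) assms(4) by blast
  then obtain P Q where PQ: "sides S (path_image \<gamma>) P Q"
    using closed_curve_sides[OF \<gamma>(1-3)] pt_in_S[OF assms(4)] by blast
  then have "separator a b (path_image \<gamma>) P Q"
    unfolding separator_def using \<gamma>(3-6) by (intro conjI)
  moreover have "pt c \<in> P \<or> pt c \<in> Q"
    using sides_union[OF PQ] c pt_in_S[OF assms(4)] by blast
  ultimately show thesis
    using that separator_sym by blast
qed

lemma separator_pt:
  assumes "separator a b C P Q" "a \<in> V" "b \<in> V" "u \<in> V"
  shows "pt u \<in> C \<longleftrightarrow> u = a \<or> u = b" "pt u \<in> P \<or> pt u \<in> Q \<longleftrightarrow> u \<noteq> a \<and> u \<noteq> b"
    "\<not> (pt u \<in> P \<and> pt u \<in> Q)"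
proof -
  note C = separatorD(4)[OF assms(1)] and PQ = separatorD(5,6)[OF assms(1)]
  have "pt u \<in> pt ` {a, b} \<longleftrightarrow> u = a \<or> u = b"
    using pt_eq_iff assms(2-4) by auto
  then show 1: "pt u \<in> C \<longleftrightarrow> u = a \<or> u = b"
    using C assms(4) by blast
  show "pt u \<in> P \<or> pt u \<in> Q \<longleftrightarrow> u \<noteq> a \<and> u \<noteq> b"
    using 1 PQ(2) pt_in_S[OF assms(4)] by blast
  show "\<not> (pt u \<in> P \<and> pt u \<in> Q)"
    using PQ(1) by blast
qed

text \<open>A common point that is no vertex must be the one proper crossing that the separator
  allows, so the edge changes sides there and nowhere else.\<close>

lemma separator_crossing:
  assumes sep: "separator a b C P Q"
    and ut: "u \<in> V" "t \<in> V" "u \<noteq> t" "{u, t} \<noteq> {a, b}"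
    and x: "x \<in> C \<inter> seg u t" "x \<notin> pt ` V"
  shows "C \<inter> seg u t = {x}" "pt u \<in> P \<longleftrightarrow> pt t \<in> Q"
proof -
  have f: "{u, t} \<in> edges D" using ut edge_mem by blast
  then obtain y where y: "C \<inter> seg u t = {y}" "proper_crossing S C (seg u t) y \<or> y \<in> pt ` {u, t}"
    using separator_edge_meet[OF sep f ut(4)] x(1) by blast
  with x have "y = x" by auto
  then show eq: "C \<inter> seg u t = {x}" using y by simp
  have "x \<notin> pt ` {u, t}" using x(2) ut by blast
  then have "proper_crossing S C (seg u t) x" using y \<open>y = x\<close> by blast
  then show "pt u \<in> P \<longleftrightarrow> pt t \<in> Q"
    using proper_crossing_changes_side[of S C P Q C "seg u t" x UNIV "pt u" "pt t"]
      separatorD(1)[OF sep] seg_arc[OF ut(1-3)] seg_subset[OF ut(1-3)] eq \<open>x \<notin> pt ` {u, t}\<close>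
    by (auto simp: Int_commute)
qed

text \<open>Crossing \<open>C\<close> at a point other than a vertex would use up the single common
  point and put the two ends on different sides. If \<open>u\<close> lies on \<open>C\<close>, then
  \<open>pt u\<close> already is that single common point.\<close>

lemma separator_same_side:
  assumes sep: "separator a b C P Q" and ab: "a \<in> V" "b \<in> V"
    and ut: "u \<in> V" "t \<in> V" "u \<noteq> t" and t: "pt t \<in> P" and u: "u = a \<or> u = b \<or> pt u \<in> P"
  shows "seg u t - pt ` {a, b} \<subseteq> P"
proof -
  have tC: "t \<noteq> a" "t \<noteq> b" using separator_pt(2)[OF sep ab ut(2)] t by blast+
  then have ne: "{u, t} \<noteq> {a, b}" by auto
  have f: "{u, t} \<in> edges D" using ut edge_mem by blast
  have sides: "sides S C P Q" by (rule separatorD(1)[OF sep])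
  have only: "x \<in> pt ` {a, b}" if x: "x \<in> C \<inter> seg u t" for x
  proof (rule ccontr)
    assume "x \<notin> pt ` {a, b}"
    then have "x \<notin> pt ` V"
      using x separatorD(4)[OF sep] by blast
    note * = separator_crossing[OF sep ut ne x this]
    show False
    proof (cases "pt u \<in> P")
      case True
      then show ?thesis using *(2) t separator_pt(3)[OF sep ab ut(2)] by blast
    next
      case False
      then have "pt u \<in> C" using u separator_pt(1)[OF sep ab ut(1)] by blast
      moreover have "pt u \<in> seg u t" using pt_in_seg ut by blast
      ultimately have "pt u = x" using *(1) by blast
      then show ?thesis using \<open>x \<notin> pt ` V\<close> ut(1) by blast
    qed
  qed
  have con: "connected (seg u t - pt ` {a, b})"
  proof (cases "u = a \<or> u = b")
    case True
    have "seg u t \<inter> pt ` {a, b} = {pt u}"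
      using True pt_in_seg[OF ut] ut ab tC by auto
    then have "seg u t - pt ` {a, b} = seg u t - {pt u}" by blast
    then show ?thesis
      using arc_from_minus_start_connected[OF seg_arc[OF ut]] by simp
  next
    case False
    then have "seg u t \<inter> pt ` {a, b} = {}"
      using pt_in_seg[OF ut] ut ab tC by auto
    then have "seg u t - pt ` {a, b} = seg u t" by blast
    then show ?thesis
      using arc_from_connected[OF seg_arc[OF ut]] by simp
  qed
  show ?thesis
  proof (rule sides_connected_mem[OF sides con])
    show "seg u t - pt ` {a, b} \<subseteq> S" using seg_subset[OF ut] by blast
    show "(seg u t - pt ` {a, b}) \<inter> C = {}" using only by blast
    show "pt t \<in> P" by (rule t)
    have "pt t \<notin> pt ` {a, b}" using tC pt_eq_iff ut ab by auto
    then show "pt t \<in> seg u t - pt ` {a, b}" using pt_in_seg ut by blast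
  qed
qed

text \<open>A crossing point is no vertex, so it would lie in \<open>Q\<close> and in
  \<open>P \<union> C\<close> at once. The curve is included on the first side to admit the edge
  \<open>ab\<close> itself.\<close>

lemma separator_opposite_no_cross:
  assumes sep: "separator a b C P Q" and ab: "a \<in> V" "b \<in> V"
    and e: "e \<in> edges D" "edge_image D e - pt ` {a, b} \<subseteq> P \<union> C"
    and f: "f \<in> edges D" "edge_image D f - pt ` {a, b} \<subseteq> Q"
  shows "\<not> cross e f"
proof
  assume c: "cross e f"
  then obtain x where x: "edge_image D e \<inter> edge_image D f = {x}" "x \<notin> pt ` V"
    using crossing_point[OF e(1) f(1)] by metis
  then have "x \<in> P \<union> C" "x \<in> Q"
    using e(2) f(2) ab by blast+
  then show False
    using separatorD(5,6)[OF sep] by blast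
qed

section \<open>Crossings among a few vertices\<close>

lemma cross_separates:
  assumes "cross {a, b} {u, t}" "a \<in> V" "b \<in> V" "a \<noteq> b" "u \<in> V" "t \<in> V" "u \<noteq> t"
    and sep: "separator a b C P Q"
  shows "pt u \<in> P \<longleftrightarrow> pt t \<in> Q" "C \<inter> seg u t = seg a b \<inter> seg u t"
proof -
  obtain x where x: "seg a b \<inter> seg u t = {x}" "x \<notin> pt ` V"
    using crossing_point[of "{a, b}" "{u, t}"] assms edge_mem by metis
  \<comment> \<open>The edge \<open>ab\<close> is part of \<open>C\<close>, so its crossing with
    \<open>ut\<close> already is the only point that \<open>C\<close> and \<open>ut\<close> may
    share.\<close>
  then have xC: "x \<in> C \<inter> seg u t"
    using separatorD(3)[OF sep] by blast
  have "{u, t} \<noteq> {a, b}"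
    using assms(1) unfolding cross_def by blast
  note * = separator_crossing[OF sep assms(5-7) this xC x(2)]
  show "pt u \<in> P \<longleftrightarrow> pt t \<in> Q" by (rule *(2))
  show "C \<inter> seg u t = seg a b \<inter> seg u t" using *(1) x(1) by simp
qed

text \<open>The separator of \<open>cd\<close> puts \<open>v\<close> and \<open>p\<close> on
  opposite sides, and with them the edges \<open>vc\<close> and \<open>pd\<close>.\<close>

lemma cross_unique_in_four:
  assumes "cross {v, p} {c, d}" "v \<in> V" "p \<in> V" "c \<in> V" "d \<in> V" "v \<noteq> p" "c \<noteq> d"
  shows "\<not> cross {p, d} {v, c}"
proof -
  have ne: "v \<noteq> c" "v \<noteq> d" "p \<noteq> c" "p \<noteq> d"
    using assms(1) unfolding cross_def by auto
  obtain C P Q where sep: "separator c d C P Q" "pt p \<in> Q"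
    using separator_exists[of c d p] assms ne by metis
  then have vP: "pt v \<in> P"
    using cross_separates(1)[OF cross_sym[OF assms(1)] assms(4,5,7) assms(2,3,6) sep(1)] by blast
  have "seg c v - pt ` {c, d} \<subseteq> P"
    by (rule separator_same_side[OF sep(1)]) (use assms ne vP in auto)
  moreover have "seg d p - pt ` {c, d} \<subseteq> Q"
    by (rule separator_same_side[OF separator_sym[OF sep(1)]]) (use assms ne sep(2) in auto)
  ultimately have "\<not> cross {c, v} {d, p}"
    by (intro separator_opposite_no_cross[OF sep(1)]) (use assms ne edge_mem in auto)
  then show ?thesis
    using cross_sym by (metis insert_commute)
qed

text \<open>With respect to the separator of \<open>cd\<close>, the edge \<open>pd\<close> stays on
  the side of \<open>p\<close>, opposite to \<open>v\<close>, whereas \<open>s\<close> stops at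
  \<open>cd\<close> and so remains on the side of \<open>v\<close>.\<close>

lemma beyond_edge_avoids_initial_arc:
  assumes y: "cross {v, y} {c, d}" and p: "cross {v, p} {c, d}"
    and mem: "v \<in> V" "y \<in> V" "p \<in> V" "c \<in> V" "d \<in> V" "v \<noteq> y" "v \<noteq> p" "c \<noteq> d"
    and s: "arc_from (pt v) x s" "s \<subseteq> seg v y" "s \<inter> seg c d = {x}"
  shows "seg p d \<inter> s = {}"
proof -
  have ne: "v \<noteq> c" "v \<noteq> d" "p \<noteq> c" "p \<noteq> d" "y \<noteq> d"
    using p y unfolding cross_def by auto
  obtain C P Q where sep: "separator c d C P Q" "pt p \<in> Q"
    using separator_exists[of c d p] mem ne by metis
  then have vP: "pt v \<in> P"
    using cross_separates(1)[OF cross_sym[OF p] mem(4,5,8) mem(1,3,7) sep(1)] by blast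
  have sides: "sides S C P Q" by (rule separatorD(1)[OF sep(1)])
  have sC: "C \<inter> s = {x}"
    using cross_separates(2)[OF cross_sym[OF y] mem(4,5,8) mem(1,2,6) sep(1)] s(2,3) by blast
  have sP: "s - {x} \<subseteq> P"
  proof (rule sides_connected_mem[OF sides arc_from_minus_end_connected[OF s(1)]])
    show "s - {x} \<subseteq> S" using s(2) seg_subset mem by blast
    show "(s - {x}) \<inter> C = {}" using sC by blast
    show "pt v \<in> s - {x}" using arc_from_endpoints[OF s(1)] by blast
  qed (rule vP)
  have "seg d p - pt ` {c, d} \<subseteq> Q"
    by (rule separator_same_side[OF separator_sym[OF sep(1)]]) (use mem ne sep(2) in auto)
  moreover have "pt c \<notin> seg d p" "pt d \<notin> s"
    using pt_in_seg[of d p c] pt_in_seg[of v y d] s(2) mem ne by auto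
  \<comment> \<open>The end \<open>x\<close> of \<open>s\<close> lies on the separator itself and is
    treated apart: as a point of \<open>cd\<close> it could lie on \<open>pd\<close> only as the
    vertex \<open>d\<close>.\<close>
  moreover have "x \<notin> seg d p"
  proof
    assume "x \<in> seg d p"
    moreover have "x \<in> seg d c" using s(3) by (metis Int_iff insertI1 insert_commute)
    ultimately have "x = pt d"
      using seg_adjacent[of d p c] mem ne by blast
    then show False using \<open>pt d \<notin> s\<close> s(3) by blast
  qed
  moreover have "P \<inter> Q = {}" by (rule sides_disjoint[OF sides])
  ultimately have "seg d p \<inter> s = {}"
    using sP by auto
  then show ?thesis by (simp add: insert_commute)
qed

end

section \<open>Uncrossed edges from a vertex to a plane graph\<close>

context separable_complete_drawing
begin

context
  fixes v :: 'v and U :: "'v set" and F :: "'v set set"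
  assumes v: "v \<in> V" and U: "U \<subseteq> V - {v}" and F: "F \<subseteq> all_edges U"
    and plane: "\<And>e f. e \<in> F \<Longrightarrow> f \<in> F \<Longrightarrow> \<not> cross e f"
begin

lemma U_V: "u \<in> U \<Longrightarrow> u \<in> V" and U_ne: "u \<in> U \<Longrightarrow> u \<noteq> v"
  using U by auto

lemma F_mem:
  assumes "{c, d} \<in> F" shows "c \<in> U" "d \<in> U" "c \<noteq> d"
proof -
  have "{c, d} \<subseteq> U" "card {c, d} = 2"
    using assms F unfolding all_edges_def by blast+
  then show "c \<in> U" "d \<in> U" "c \<noteq> d" by auto
qed

lemma F_edges: "F \<subseteq> edges D"
  using F U unfolding complete all_edges_def by blast

text \<open>
  Going along \<open>vy\<close> from \<open>v\<close>, the point \<open>x\<close> on \<open>cd\<close> is the first one on an edge of \<open>F\<close>; \<open>s1\<close>, \<open>s2\<close>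
  and \<open>s3\<close> are the arcs from \<open>x\<close> to \<open>v\<close>, \<open>c\<close> and \<open>d\<close>. Edges of \<open>F\<close> at \<open>y\<close> do not count, as they
  meet \<open>vy\<close> beyond \<open>x\<close>.
\<close>

definition first_block ::
    "'v \<Rightarrow> 'v \<Rightarrow> 'v \<Rightarrow> 'a \<Rightarrow> 'a set \<Rightarrow> 'a set \<Rightarrow> 'a set \<Rightarrow> bool" where
  "first_block y c d x s1 s2 s3 \<longleftrightarrow>
     {c, d} \<in> F \<and> cross {v, y} {c, d} \<and> x \<notin> pt ` V \<and>
     arc_from (pt v) x s1 \<and> s1 \<subseteq> seg v y \<and> (\<Union>f\<in>F. edge_image D f) \<inter> s1 = {x} \<and>
     arc_from x (pt c) s2 \<and> arc_from x (pt d) s3 \<and> s2 \<union> s3 = seg c d \<and> s2 \<inter> s3 = {x}"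

lemma first_blockD:
  assumes "first_block y c d x s1 s2 s3"
  shows "{c, d} \<in> F" "cross {v, y} {c, d}" "x \<notin> pt ` V" "arc_from (pt v) x s1" "s1 \<subseteq> seg v y"
    "(\<Union>f\<in>F. edge_image D f) \<inter> s1 = {x}" "arc_from x (pt c) s2" "arc_from x (pt d) s3"
    "s2 \<union> s3 = seg c d" "s2 \<inter> s3 = {x}"
  using assms unfolding first_block_def by simp_all

lemma first_block_sym: "first_block y c d x s1 s2 s3 \<Longrightarrow> first_block y d c x s1 s3 s2"
  unfolding first_block_def by (simp add: insert_commute Un_commute Int_commute)

text \<open>Only edges of \<open>F\<close> that cross \<open>vy\<close> are used to find the first
  hit. Any other edge of \<open>F\<close> that meets \<open>s1\<close> contains \<open>y\<close>,
  since \<open>v\<close> is not in \<open>U\<close>, and it meets \<open>vy\<close> just at the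
  point of \<open>y\<close>; that point belongs to \<open>s1\<close> only if it is
  \<open>x\<close>.\<close>

lemma first_block_exists:
  assumes y: "y \<in> U" and f: "f \<in> F" "cross {v, y} f"
  obtains c d x s1 s2 s3 where "first_block y c d x s1 s2 s3"
proof -
  define G where "G = {f \<in> F. cross {v, y} f}"
  define H where "H = (\<Union>f\<in>G. edge_image D f)"
  have vy: "v \<in> V" "y \<in> V" "v \<noteq> y" using v y U by auto
  have "finite F"
    using F_edges finite_V unfolding complete all_edges_def
    by (metis (no_types, lifting) Collect_mono PowI finite_Pow_iff finite_subset mem_Collect_eq subsetI)
  have "closed H"
    unfolding H_def
  proof (rule closed_UN)
    show "finite G" using \<open>finite F\<close> unfolding G_def by simp
    show "\<forall>f\<in>G. closed (edge_image D f)"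
    proof
      fix f assume "f \<in> G"
      then obtain a b where "f = {a, b}" "a \<in> V" "b \<in> V" "a \<noteq> b"
        using F_edges edgeE unfolding G_def by blast
      then show "closed (edge_image D f)" using arc_from_closed seg_arc by blast
    qed
  qed
  moreover have "pt v \<notin> H"
  proof
    assume "pt v \<in> H"
    then obtain f where "f \<in> G" "pt v \<in> edge_image D f" unfolding H_def by blast
    then have "v \<in> f"
      using pt_in_edge_image v F_edges unfolding G_def by blast
    then show False using \<open>f \<in> G\<close> unfolding G_def cross_def by blast
  qed
  moreover have "seg v y \<inter> H \<noteq> {}"
    using f unfolding H_def G_def cross_def by blast
  ultimately obtain x s1 where s1: "arc_from (pt v) x s1" "s1 \<subseteq> seg v y" "s1 \<inter> H = {x}"
    "pt y \<in> s1 \<Longrightarrow> x = pt y"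
    using arc_from_first_hit[OF seg_arc[OF vy]] by metis
  then obtain f0 where f0: "f0 \<in> G" "x \<in> edge_image D f0"
    unfolding H_def by blast
  have e: "{v, y} \<in> edges D" "f0 \<in> edges D" "f0 \<in> F" "cross {v, y} f0"
    using vy edge_mem F_edges f0(1) unfolding G_def by auto
  obtain c d where cd: "f0 = {c, d}" "c \<in> V" "d \<in> V" "c \<noteq> d"
    using edgeE[OF e(2)] .
  have "x \<in> seg v y" using s1(2,3) by blast
  then have x: "x \<notin> pt ` V"
    using crossing_point[OF e(1,2,4)] f0(2) by (metis IntI singletonD)
  have "x \<noteq> pt c" "x \<noteq> pt d" using x cd by blast+
  then obtain s2 s3 where s23: "arc_from (pt c) x s2" "arc_from x (pt d) s3" "s2 \<union> s3 = seg c d" "s2 \<inter> s3 = {x}"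
    using arc_from_split[OF seg_arc[OF cd(2-4)], of x] f0(2) cd(1) by blast
  have "(\<Union>f\<in>F. edge_image D f) \<inter> s1 \<subseteq> {x}"
  proof
    fix z assume "z \<in> (\<Union>f\<in>F. edge_image D f) \<inter> s1"
    then obtain g where g: "g \<in> F" "z \<in> edge_image D g" "z \<in> s1" by blast
    show "z \<in> {x}"
    proof (cases "cross {v, y} g")
      case True
      then have "z \<in> H" using g unfolding H_def G_def by blast
      then show ?thesis using s1(3) g(3) by blast
    next
      case False
      have "v \<notin> g" using g(1) F U unfolding all_edges_def by blast
      then have "y \<in> g" using False g s1(2) unfolding cross_def by blast
      have "z \<in> {pt y}"
        using edge_images_adjacent[of "{v, y}" g y] e(1) g F_edges \<open>y \<in> g\<close> \<open>v \<notin> g\<close> s1(2) by blast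
      then show ?thesis using s1(4) g(3) by blast
    qed
  qed
  moreover have "x \<in> (\<Union>f\<in>F. edge_image D f) \<inter> s1"
    using e(3) f0(2) s1(3) by blast
  ultimately have hit: "(\<Union>f\<in>F. edge_image D f) \<inter> s1 = {x}" by blast
  have "{c, d} \<in> F" "cross {v, y} {c, d}"
    using e(3,4) cd(1) by simp_all
  then have "first_block y c d x s1 s2 s3"
    unfolding first_block_def
    by (intro conjI x s1(1,2) hit arc_from_sym[OF s23(1)] s23(2-4))
  then show thesis by (rule that)
qed

text \<open>Edges with a common end meet only there, so \<open>s1\<close>, \<open>s2\<close> and
  \<open>vc\<close> pairwise share just their common ends and form a closed curve. The fact on
  \<open>seg v d\<close> serves to compare this curve with the one through \<open>d\<close>.\<close>

lemma first_block_facts: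
  assumes y: "y \<in> U" and fb: "first_block y c d x s1 s2 s3"
  shows "c \<in> U" "d \<in> U" "c \<noteq> d" "y \<noteq> c" "y \<noteq> d"
    "s1 \<inter> seg c d = {x}" "s1 \<inter> s2 = {x}" "s2 \<inter> seg v c = {pt c}" "seg v c \<inter> s1 = {pt v}"
    "pt d \<notin> s2" "seg v d \<inter> s2 = {}" "s2 \<subseteq> seg c d"
proof -
  note f = first_blockD[OF fb]
  show c: "c \<in> U" and d: "d \<in> U" and cd: "c \<noteq> d" using F_mem[OF f(1)] .
  show yc: "y \<noteq> c" and yd: "y \<noteq> d" using f(2) unfolding cross_def by auto
  show s2: "s2 \<subseteq> seg c d" using f(9) by (metis Un_upper1)
  note V = U_V[OF c] U_V[OF d] U_V[OF y] v
  note ne = U_ne[OF c] U_ne[OF d] U_ne[OF y]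
  have "x \<in> seg c d" using f(9,10) by blast
  then show s1cd: "s1 \<inter> seg c d = {x}" using f(1,6) by blast
  show "s1 \<inter> s2 = {x}" using s1cd f(9,10) by blast
  have "s2 \<inter> seg v c \<subseteq> {pt c}"
    using seg_adjacent[of c d v] V ne cd f(9) by (auto simp: insert_commute)
  then show "s2 \<inter> seg v c = {pt c}"
    using arc_from_endpoints[OF f(7)] pt_in_seg[of v c c] V ne by blast
  have "seg v c \<inter> s1 \<subseteq> {pt v}"
    using seg_adjacent[of v c y] V ne yc f(5) by auto
  then show "seg v c \<inter> s1 = {pt v}"
    using arc_from_endpoints[OF f(4)] pt_in_seg[of v c v] V ne by blast
  have "pt d \<noteq> x" using f(3) V(2) by blast
  then show dn: "pt d \<notin> s2" using arc_from_endpoints[OF f(8)] f(10) by blast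
  have "seg v d \<inter> seg c d \<subseteq> {pt d}"
    using seg_adjacent[of d c v] V ne cd by (auto simp: insert_commute)
  then show "seg v d \<inter> s2 = {}" using dn f(9) by blast
qed

text \<open>The vertex \<open>d\<close> lies off the curve and names its sides: \<open>Y\<close> is
  the one with \<open>d\<close>, and \<open>Z\<close> is the region in which an uncrossed edge is
  sought.\<close>

lemma first_block_curve:
  assumes y: "y \<in> U" and fb: "first_block y c d x s1 s2 s3"
  shows "s1 \<union> s2 \<union> seg v c \<subseteq> S" "pt d \<notin> s1 \<union> s2 \<union> seg v c"
    "\<exists>Z Y. sides S (s1 \<union> s2 \<union> seg v c) Z Y \<and> pt d \<in> Y"
proof -
  note f = first_blockD[OF fb] and g = first_block_facts[OF y fb]
  have V: "c \<in> V" "d \<in> V" "y \<in> V" "v \<noteq> c" "v \<noteq> d" "v \<noteq> y"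
    using U_V U_ne g(1,2) y by auto
  show sub: "s1 \<union> s2 \<union> seg v c \<subseteq> S"
    using f(5,9) seg_subset v V g(3) by blast
  show d: "pt d \<notin> s1 \<union> s2 \<union> seg v c"
    using g(3,5,10) f(5) pt_in_seg[of v y d] pt_in_seg[of v c d] v V by blast
  have arc: "arc_from (pt c) (pt v) (seg v c)"
    using arc_from_sym seg_arc v V by blast
  obtain \<gamma> where \<gamma>: "simple_path \<gamma>" "pathfinish \<gamma> = pathstart \<gamma>" "path_image \<gamma> = s1 \<union> s2 \<union> seg v c"
    using closed_curve_of_three_arcs[OF f(4) f(7) arc g(7,8,9)] .
  obtain P Q where PQ: "sides S (s1 \<union> s2 \<union> seg v c) P Q"
    using closed_curve_sides[OF \<gamma>(1,2), of "pt d", unfolded \<gamma>(3), OF sub pt_in_S[OF V(2)] d] .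
  then have "pt d \<in> P \<or> pt d \<in> Q"
    using sides_union[OF PQ] d pt_in_S[OF V(2)] by blast
  then show "\<exists>Z Y. sides S (s1 \<union> s2 \<union> seg v c) Z Y \<and> pt d \<in> Y"
    using PQ sides_sym[OF PQ] by metis
qed

text \<open>Induction on the number of vertices of \<open>U\<close> in \<open>Z\<close>. The first
  edge \<open>pq\<close> of \<open>F\<close> that blocks \<open>vc\<close> has one end
  \<open>p\<close> in \<open>Z\<close>, and the vertices \<open>y\<close>, \<open>c\<close>,
  \<open>d\<close> are replaced by \<open>c\<close>, \<open>p\<close>, \<open>q\<close>. The answer
  for the new region is valid for the old one because both \<open>p\<close> and the new region lie
  in \<open>Z\<close>.\<close>

lemma first_block_descent:
  assumes "y \<in> U" "first_block y c d x s1 s2 s3"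
    "sides S (s1 \<union> s2 \<union> seg v c) Z Y" "pt d \<in> Y"
  shows "\<exists>z\<in>U. (z = c \<or> pt z \<in> Z) \<and> (\<forall>f\<in>F. \<not> cross {v, z} f)"
  using assms
proof (induction "card {u \<in> U. pt u \<in> Z}" arbitrary: y c d x s1 s2 s3 Z Y rule: less_induct)
  case less
  note y = less.prems(1) and fb = less.prems(2) and sid = less.prems(3) and d = less.prems(4)
  note f = first_blockD[OF fb] and g = first_block_facts[OF y fb]
  have V: "c \<in> V" "d \<in> V" "y \<in> V" "v \<in> V" "v \<noteq> c" "v \<noteq> d" "v \<noteq> y"
    using U_V U_ne g(1,2) y v by auto
  let ?J = "s1 \<union> s2 \<union> seg v c"
  note J = first_block_curve(1,2)[OF y fb] and dis = sides_disjoint[OF sid] and uni = sides_union[OF sid]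
  show ?case
  proof (cases "\<forall>f\<in>F. \<not> cross {v, c} f")
    case True
    then show ?thesis using g(1) by blast
  next
    case False
    then obtain f' where "f' \<in> F" "cross {v, c} f'" by blast
    from first_block_exists[OF g(1) this] obtain p0 q0 x' t1 t20 t30
      where fb0: "first_block c p0 q0 x' t1 t20 t30" .
    \<comment> \<open>The blocking edge meets the closed curve exactly once, at a proper crossing
      with \<open>vc\<close>, so its ends lie on different sides. The end in \<open>Z\<close> is
      called \<open>p\<close>.\<close>
    have "\<exists>p q t2 t3. first_block c p q x' t1 t2 t3 \<and> pt p \<in> Z \<and> pt q \<in> Y \<and> seg p q \<inter> ?J = {x'}"
    proof -
      note h = first_blockD[OF fb0] and k = first_block_facts[OF g(1) fb0]
      have W: "p0 \<in> V" "q0 \<in> V" using k U_V by auto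
      have x': "x' \<in> seg v c" "x' \<in> seg p0 q0"
        using h(5,9,10) arc_from_endpoints(2)[OF h(4)] by blast+
      have e: "{v, c} \<in> edges D" "{p0, q0} \<in> edges D" "{c, d} \<in> edges D"
        using edge_mem V F_edges h(1) f(1) by auto
      obtain x'' where x'': "seg v c \<inter> seg p0 q0 = {x''}" "proper_crossing S (seg v c) (seg p0 q0) x''"
        using crossing_point[OF e(1,2) h(2)] .
      then have "x'' = x'" using x' by (metis IntI singletonD)
      then have vc_pq: "seg v c \<inter> seg p0 q0 = {x'}" using x''(1) by simp
      have ne: "{p0, q0} \<noteq> {c, d}" using k(4,5) by auto
      \<comment> \<open>By planarity of \<open>F\<close> the two edges can meet only in a common
        vertex, and \<open>c\<close> is excluded because the blocking edge crosses
        \<open>vc\<close>.\<close>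
      have pqcd: "seg p0 q0 \<inter> seg c d \<subseteq> {pt d}"
      proof (cases "{p0, q0} \<inter> {c, d} = {}")
        case True
        then show ?thesis
          using plane[OF h(1) f(1)] unfolding cross_def by blast
      next
        case False
        then have "d \<in> {p0, q0}" using k(4,5) by blast
        then show ?thesis using edge_images_adjacent[OF e(2,3) ne, of d] by blast
      qed
      then have 1: "seg p0 q0 \<inter> s2 = {}" using f(9) g(10) by blast
      have "seg p0 q0 \<inter> s1 \<subseteq> {x}" using f(6) h(1) by blast
      moreover have "x \<notin> seg p0 q0" using pqcd g(6) f(3) V(2) by blast
      ultimately have 2: "seg p0 q0 \<inter> s1 = {}" by blast
      have inter: "seg p0 q0 \<inter> ?J = {x'}" using 1 2 vc_pq by blast
      have "pt p0 \<in> Z \<longleftrightarrow> pt q0 \<in> Y"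
      proof (rule proper_crossing_changes_side[OF sid x''(2)[unfolded \<open>x'' = x'\<close>]])
        show "open (- (s1 \<union> s2))"
          using arc_from_closed f(4,7) by (metis closed_Un open_Compl)
        show "x' \<in> - (s1 \<union> s2)" using 1 2 x'(2) by blast
        show "?J \<inter> - (s1 \<union> s2) = seg v c \<inter> - (s1 \<union> s2)" by blast
        show "arc_from (pt p0) (pt q0) (seg p0 q0)" using seg_arc W k(3) by blast
        show "seg p0 q0 \<subseteq> S" using seg_subset W k(3) by blast
        show "seg p0 q0 \<inter> ?J = {x'}" by (rule inter)
        show "x' \<noteq> pt p0" "x' \<noteq> pt q0" using h(3) W by blast+
      qed
      moreover have "pt p0 \<in> Z \<union> Y"
      proof -
        have "pt p0 \<in> seg p0 q0" using pt_in_seg W k(3) by blast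
        moreover have "pt p0 \<noteq> x'" using h(3) W by blast
        ultimately show ?thesis using inter uni pt_in_S[OF W(1)] by blast
      qed
      moreover have "pt q0 \<in> Z \<union> Y"
      proof -
        have "pt q0 \<in> seg p0 q0" using pt_in_seg W k(3) by blast
        moreover have "pt q0 \<noteq> x'" using h(3) W by blast
        ultimately show ?thesis using inter uni pt_in_S[OF W(2)] by blast
      qed
      ultimately have "pt p0 \<in> Z \<and> pt q0 \<in> Y \<or> pt q0 \<in> Z \<and> pt p0 \<in> Y"
        using dis by blast
      then show ?thesis
      proof
        assume "pt p0 \<in> Z \<and> pt q0 \<in> Y"
        then show ?thesis
          using fb0 inter by (intro exI[of _ p0] exI[of _ q0] exI[of _ t20] exI[of _ t30] conjI) simp_all
      next
        assume "pt q0 \<in> Z \<and> pt p0 \<in> Y"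
        moreover have "seg q0 p0 \<inter> ?J = {x'}" using inter by (simp add: insert_commute)
        ultimately show ?thesis
          using first_block_sym[OF fb0]
          by (intro exI[of _ q0] exI[of _ p0] exI[of _ t30] exI[of _ t20] conjI) simp_all
      qed
    qed
    then obtain p q t2 t3 where fb': "first_block c p q x' t1 t2 t3"
      and pq: "pt p \<in> Z" "pt q \<in> Y" and inter: "seg p q \<inter> ?J = {x'}" by blast
    note h = first_blockD[OF fb'] and k = first_block_facts[OF g(1) fb']
    have W: "p \<in> V" "q \<in> V" "v \<noteq> p" "v \<noteq> q"
      using U_V[OF k(1)] U_V[OF k(2)] U_ne[OF k(1)] U_ne[OF k(2)] by auto
    have pJ: "pt p \<notin> ?J" using pq(1) uni by blast
    have pd: "p \<noteq> d" using pq(1) d dis by blast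
    have pc: "p \<noteq> c" using k(4) by simp
    have dp_s2: "seg p d \<inter> s2 = {}"
    proof -
      have "seg p d \<inter> seg c d \<subseteq> {pt d}"
        using seg_adjacent[of d p c] V W pd pc g(3) by (simp add: insert_commute)
      then show ?thesis using g(10,12) by blast
    qed
    \<comment> \<open>The edge \<open>pd\<close> runs from \<open>Z\<close> to \<open>Y\<close>, so
      it must meet the curve. As \<open>s2\<close> is excluded, it meets \<open>s1\<close> unless it
      crosses \<open>vc\<close>; the next two claims reach contradictions by excluding both.\<close>
    have meets: "seg p d \<inter> s1 \<noteq> {}" if "\<not> cross {p, d} {v, c}"
    proof
      assume "seg p d \<inter> s1 = {}"
      moreover have "seg p d \<inter> seg v c = {}"
        using that V W pc pd g(3) unfolding cross_def by auto
      ultimately have "seg p d \<inter> ?J = {}" using dp_s2 by blast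
      moreover have "connected (seg p d)" "seg p d \<subseteq> S" "pt p \<in> seg p d" "pt d \<in> seg p d"
        using arc_from_connected[OF seg_arc[OF W(1) V(2) pd]] seg_subset[OF W(1) V(2) pd]
          pt_in_seg[OF W(1) V(2) pd] W(1) V(2) by simp_all
      ultimately have "pt d \<in> Z"
        using sides_connected_mem[OF sid, of "seg p d" "pt p"] pq(1) by blast
      then show False using d dis by blast
    qed
    have py: "p \<noteq> y"
    proof
      assume "p = y"
      have "seg p d \<inter> seg v y \<subseteq> {pt y}"
        using seg_adjacent[of y d v] V g(5) \<open>p = y\<close> by (simp add: insert_commute)
      moreover have "pt y \<notin> s1" using pJ \<open>p = y\<close> by blast
      ultimately have "seg p d \<inter> s1 = {}"
        using f(5) by blast
      moreover have "\<not> cross {p, d} {v, c}"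
        using cross_unique_in_four[of v y c d] f(2) V g(3) \<open>p = y\<close> by blast
      ultimately show False using meets by blast
    qed
    \<comment> \<open>Separability of \<open>cd\<close> enters: if \<open>p\<close> lay beyond
      \<open>cd\<close> as seen from \<open>v\<close>, then \<open>pd\<close> would stay beyond and
      meet neither \<open>vc\<close> nor \<open>s1\<close>.\<close>
    have vp_cd: "\<not> cross {v, p} {c, d}"
    proof
      assume vp: "cross {v, p} {c, d}"
      then have "\<not> cross {p, d} {v, c}"
        using cross_unique_in_four V W g(3) by blast
      moreover have "seg p d \<inter> s1 = {}"
        by (rule beyond_edge_avoids_initial_arc[OF f(2) vp]) (use V W g(3,6) f(4,5) in auto)
      ultimately show False using meets by blast
    qed
    have vpJ: "seg v p \<inter> ?J = {pt v}"
    proof -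
      have "seg v p \<inter> s1 \<subseteq> {pt v}"
        using seg_adjacent[of v p y] V W py f(5) by auto
      moreover have "seg v p \<inter> s2 = {}"
        using vp_cd g(12) V W pc pd unfolding cross_def by auto
      moreover have "seg v p \<inter> seg v c = {pt v}"
        using seg_adjacent[of v p c] V W pc by auto
      ultimately show ?thesis by auto
    qed
    have vpZ: "seg v p - {pt v} \<subseteq> Z"
    proof (rule sides_connected_mem[OF sid])
      show "connected (seg v p - {pt v})"
        using arc_from_minus_start_connected[OF seg_arc[OF V(4) W(1,3)]] .
      show "seg v p - {pt v} \<subseteq> S" using seg_subset[OF V(4) W(1,3)] by blast
      show "(seg v p - {pt v}) \<inter> ?J = {}" using equalityD1[OF vpJ] by blast
      show "pt p \<in> seg v p - {pt v}" using pt_in_seg[of v p p] pt_eq_iff[of p v] V W by simp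
    qed (rule pq(1))
    have t2Z: "t2 - {x'} \<subseteq> Z"
    proof (rule sides_connected_mem[OF sid])
      show "connected (t2 - {x'})" using arc_from_minus_start_connected[OF h(7)] .
      show "t2 - {x'} \<subseteq> S" using k(12) seg_subset[OF W(1,2) k(3)] by blast
      show "(t2 - {x'}) \<inter> ?J = {}" using equalityD1[OF inter] k(12) by blast
      show "pt p \<in> t2 - {x'}" using arc_from_endpoints[OF h(7)] by blast
    qed (rule pq(1))
    \<comment> \<open>The new curve lies in \<open>Z \<union> ?J\<close> and so avoids
      \<open>Y\<close>, which falls into \<open>Y'\<close> together with \<open>q\<close>. An open
      set \<open>Z'\<close> disjoint from \<open>Y\<close> contains no point of \<open>?J\<close>,
      where \<open>Y\<close> accumulates; this leaves \<open>Z' \<subseteq> Z\<close>.\<close>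
    let ?J' = "t1 \<union> t2 \<union> seg v p"
    have "x' \<in> ?J" using inter by blast
    moreover have "pt v \<in> ?J" using pt_in_seg[of v c v] V by blast
    ultimately have J'Z: "?J' \<subseteq> Z \<union> ?J" using vpZ t2Z h(5) by blast
    obtain Z' Y' where sid': "sides S ?J' Z' Y'" and q: "pt q \<in> Y'"
      using first_block_curve(3)[OF g(1) fb'] by blast
    have "Y \<subseteq> Y'"
    proof (rule sides_connected_mem[OF sides_sym[OF sid']])
      show "connected Y" using sid unfolding sides_def by blast
      show "Y \<subseteq> S" using uni by blast
      show "Y \<inter> ?J' = {}" using J'Z dis uni by blast
    qed (use pq(2) q in auto)
    then have Z'Y: "Z' \<inter> Y = {}" using sides_disjoint[OF sid'] by blast
    have "openin (top_of_set S) Z'" using sid' unfolding sides_def by blast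
    then have "Z' \<inter> ?J = {}"
      using sides_frontier(2)[OF sid] Z'Y by blast
    then have Z'Z: "Z' \<subseteq> Z"
      using Z'Y uni sides_union[OF sid'] by blast
    \<comment> \<open>The count drops strictly, as \<open>p\<close> lies in \<open>Z\<close> and on
      the new curve.\<close>
    have "pt p \<notin> Z'"
      using sides_union[OF sid'] pt_in_seg[of v p p] V W by blast
    then have "{u \<in> U. pt u \<in> Z'} \<subset> {u \<in> U. pt u \<in> Z}"
      using Z'Z pq(1) k(1) by blast
    moreover have "finite U" using U finite_V finite_subset by blast
    ultimately have "card {u \<in> U. pt u \<in> Z'} < card {u \<in> U. pt u \<in> Z}"
      by (simp add: psubset_card_mono)
    from less.hyps[OF this g(1) fb' sid' q] show ?thesis
      using pq(1) Z'Z by blast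
  qed
qed

text \<open>The two curves share \<open>s1\<close>; the rest of the curve through \<open>d\<close>
  is joined to \<open>d\<close> without meeting the curve through \<open>c\<close>, hence lies in
  \<open>Yc\<close>. So \<open>Zc\<close> avoids the whole curve through \<open>d\<close>. It has
  points in the open set \<open>Yd\<close> near \<open>c\<close>, and being connected it lies in
  \<open>Yd\<close>.\<close>

lemma first_block_regions_disjoint:
  assumes y: "y \<in> U" and fb: "first_block y c d x s1 s2 s3"
    and c: "sides S (s1 \<union> s2 \<union> seg v c) Zc Yc" "pt d \<in> Yc"
    and d: "sides S (s1 \<union> s3 \<union> seg v d) Zd Yd" "pt c \<in> Yd"
  shows "Zc \<inter> Zd = {}"
proof -
  note f = first_blockD[OF fb] and g = first_block_facts[OF y fb]
    and g' = first_block_facts[OF y first_block_sym[OF fb]]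
  have V: "c \<in> V" "d \<in> V" "y \<in> V" "v \<in> V" "v \<noteq> c" "v \<noteq> d" "v \<noteq> y"
    using U_V U_ne g(1,2) y v by auto
  let ?Jc = "s1 \<union> s2 \<union> seg v c" and ?Jd = "s1 \<union> s3 \<union> seg v d"
  have "s3 - {x} \<subseteq> Yc"
  proof (rule sides_connected_mem[OF sides_sym[OF c(1)]])
    show "connected (s3 - {x})" using arc_from_minus_start_connected[OF f(8)] .
    have s3: "s3 \<subseteq> seg c d" using f(9) by (metis Un_upper2)
    show "s3 - {x} \<subseteq> S" using s3 seg_subset[OF V(1,2) g(3)] by blast
    show "(s3 - {x}) \<inter> ?Jc = {}"
      using s3 equalityD1[OF f(10)] equalityD1[OF g(6)] g'(11) by blast
    show "pt d \<in> s3 - {x}" using arc_from_endpoints[OF f(8)] by blast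
  qed (rule c(2))
  moreover have "seg v d - {pt v} \<subseteq> Yc"
  proof (rule sides_connected_mem[OF sides_sym[OF c(1)]])
    show "connected (seg v d - {pt v})" using arc_from_minus_start_connected[OF seg_arc[OF V(4,2,6)]] .
    show "seg v d - {pt v} \<subseteq> S" using seg_subset[OF V(4,2,6)] by blast
    show "(seg v d - {pt v}) \<inter> ?Jc = {}"
      using g(11) g'(9) seg_adjacent[of v d c] V g(3) by auto
    show "pt d \<in> seg v d - {pt v}" using pt_in_seg[of v d d] pt_eq_iff[of d v] V by simp
  qed (rule c(2))
  moreover have "x \<in> ?Jc" "pt v \<in> ?Jc"
    using arc_from_endpoints[OF f(4)] by blast+
  ultimately have "?Jd \<subseteq> Yc \<union> ?Jc" by blast
  then have disj: "Zc \<inter> ?Jd = {}"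
    using sides_disjoint[OF c(1)] sides_union[OF c(1)] by blast
  have "pt c \<in> ?Jc" using pt_in_seg[of v c c] V by blast
  moreover have "openin (top_of_set S) Yd" using d(1) unfolding sides_def by blast
  ultimately obtain z where "z \<in> Yd" "z \<in> Zc"
    using sides_frontier(1)[OF c(1) _ _ d(2)] by blast
  moreover have "connected Zc" using c(1) unfolding sides_def by blast
  moreover have "Zc \<subseteq> S" using sides_union[OF c(1)] by blast
  ultimately have "Zc \<subseteq> Yd"
    using sides_connected_mem[OF sides_sym[OF d(1)]] disj by blast
  then show ?thesis using sides_disjoint[OF d(1)] by blast
qed

text \<open>If \<open>vy\<close> is blocked, the descent can start from either end of the first
  blocking edge \<open>cd\<close>. One answer is \<open>c\<close> or lies in \<open>Zc\<close>, the
  other is \<open>d\<close> or lies in \<open>Zd\<close>; these candidate sets are disjoint, so one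
  of them misses \<open>x0\<close>.\<close>

lemma second_uncrossed_edge:
  assumes "x0 \<in> U" "y \<in> U" "y \<noteq> x0"
  shows "\<exists>z\<in>U. z \<noteq> x0 \<and> (\<forall>f\<in>F. \<not> cross {v, z} f)"
proof (cases "\<forall>f\<in>F. \<not> cross {v, y} f")
  case True
  then show ?thesis using assms by blast
next
  case False
  then obtain f' where "f' \<in> F" "cross {v, y} f'" by blast
  from first_block_exists[OF assms(2) this] obtain c d x s1 s2 s3
    where fb: "first_block y c d x s1 s2 s3" .
  note fb' = first_block_sym[OF fb]
  obtain Zc Yc where c: "sides S (s1 \<union> s2 \<union> seg v c) Zc Yc" "pt d \<in> Yc"
    using first_block_curve(3)[OF assms(2) fb] by blast
  obtain Zd Yd where d: "sides S (s1 \<union> s3 \<union> seg v d) Zd Yd" "pt c \<in> Yd"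
    using first_block_curve(3)[OF assms(2) fb'] by blast
  have "Zc \<inter> Zd = {}"
    using first_block_regions_disjoint[OF assms(2) fb c d] .
  moreover have "c \<noteq> d" using first_block_facts(3)[OF assms(2) fb] .
  moreover have "pt d \<notin> Zc" "pt c \<notin> Zd"
    using sides_disjoint[OF c(1)] c(2) sides_disjoint[OF d(1)] d(2) by blast+
  ultimately consider "x0 \<noteq> c" "pt x0 \<notin> Zc" | "x0 \<noteq> d" "pt x0 \<notin> Zd"
    by blast
  then show ?thesis
  proof cases
    case 1
    then show ?thesis
      using first_block_descent[OF assms(2) fb c] by metis
  next
    case 2
    then show ?thesis
      using first_block_descent[OF assms(2) fb' d] by metis
  qed
qed

end

end

section \<open>Plane Hamiltonian paths\<close>

lemma hamiltonian_path_mono: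
  "hamiltonian_path W E v w p \<Longrightarrow> E \<subseteq> E' \<Longrightarrow> hamiltonian_path W E' v w p"
  unfolding hamiltonian_path_def by (auto elim!: successively_mono)

lemma hamiltonian_path_append:
  assumes p: "hamiltonian_path W1 E v x p" and q: "hamiltonian_path W2 E x w q"
    and "W1 \<inter> W2 = {x}" "x \<noteq> w"
  shows "hamiltonian_path (W1 \<union> W2) E v w (p @ tl q)"
proof -
  obtain q' where q': "q = x # q'"
    using q unfolding hamiltonian_path_def by (cases q) auto
  \<comment> \<open>Since \<open>x \<noteq> w\<close>, dropping the second copy of \<open>x\<close>
    leaves a nonempty list, whose last vertex is still \<open>w\<close>.\<close>
  have ne: "q' \<noteq> []"
    using q assms(4) unfolding hamiltonian_path_def q' by auto
  have "W2 = insert x (set q')" "x \<notin> set q'" "distinct q'"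
    using q unfolding hamiltonian_path_def q' by auto
  moreover have "x \<in> W1" "set p = W1" "distinct p" "p \<noteq> []" "last p = x"
    using p assms(3) unfolding hamiltonian_path_def by auto
  moreover have "successively (\<lambda>x y. {x, y} \<in> E) q'" "{x, hd q'} \<in> E"
    using q ne unfolding hamiltonian_path_def q' by (auto simp: successively_Cons)
  ultimately show ?thesis
    using p q ne assms(3) unfolding hamiltonian_path_def q'
    by (auto simp: successively_append_iff)
qed

context separable_complete_drawing
begin

text \<open>The edge \<open>ab\<close> is the one exception, as it lies on \<open>C\<close>; any
  other such edge has an end in \<open>P\<close>, and \<open>separator_same_side\<close>
  applies.\<close>

lemma separator_edge_side:
  assumes sep: "separator a b C P Q" and ab: "a \<in> V" "b \<in> V"
    and e: "e \<in> edges D" "\<And>u. u \<in> e \<Longrightarrow> u = a \<or> u = b \<or> pt u \<in> P"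
  shows "edge_image D e - pt ` {a, b} \<subseteq> P \<union> C"
    and "e \<noteq> {a, b} \<Longrightarrow> edge_image D e - pt ` {a, b} \<subseteq> P"
proof -
  obtain u t where ut: "e = {u, t}" "u \<in> V" "t \<in> V" "u \<noteq> t"
    using edgeE[OF e(1)] .
  show *: "edge_image D e - pt ` {a, b} \<subseteq> P" if "e \<noteq> {a, b}"
  proof (cases "pt t \<in> P")
    case True
    then show ?thesis
      using separator_same_side[OF sep ab ut(2-4)] e(2)[of u] ut(1) by simp
  next
    case False
    then have "pt u \<in> P"
      using e(2)[of u] e(2)[of t] that ut by auto
    then show ?thesis
      using separator_same_side[OF sep ab ut(3,2)] e(2)[of t] ut by (simp add: insert_commute)
  qed
  show "edge_image D e - pt ` {a, b} \<subseteq> P \<union> C"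
    using * separatorD(3)[OF sep] by (cases "e = {a, b}") auto
qed

lemma all_edges_mono_edges: "W \<subseteq> V \<Longrightarrow> all_edges W \<subseteq> edges D"
  unfolding complete all_edges_def by auto

text \<open>Induction over vertex subsets \<open>W\<close> of one fixed drawing: the separators of
  \<open>D\<close> serve every \<open>W\<close>, and only \<open>cross\<close> between chosen edges
  has to be controlled.\<close>

lemma plane_hamiltonian_path:
  assumes "W \<subseteq> V" "v \<in> W" "w \<in> W" "v \<noteq> w"
  shows "\<exists>E p. E \<subseteq> all_edges W \<and> (\<forall>e\<in>E. \<forall>f\<in>E. \<not> cross e f) \<and>
           2 * card W - 3 \<le> card E \<and> hamiltonian_path W E v w p"
  using assms
proof (induction "card W" arbitrary: W v w rule: less_induct)
  case less
  note W = less.prems(1) and v = less.prems(2) and w = less.prems(3) and vw = less.prems(4)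
  have finW: "finite W" using W finite_V finite_subset by blast
  show ?case
  proof (cases "W = {v, w}")
    case True
    have "{{v, w}} \<subseteq> all_edges W" using True vw unfolding all_edges_def by simp
    moreover have "\<not> cross {v, w} {v, w}" unfolding cross_def by simp
    moreover have "2 * card W - 3 \<le> card {{v, w}}" using True vw by simp
    moreover have "hamiltonian_path W {{v, w}} v w [v, w]"
      using True vw unfolding hamiltonian_path_def by simp
    ultimately show ?thesis by blast
  next
    case False
    then obtain x where x: "x \<in> W" "x \<noteq> v" "x \<noteq> w" using v w by blast
    have mem: "v \<in> V" "x \<in> V" "w \<in> V" using W v w x by auto
    obtain C P Q where sep: "separator v x C P Q" and wQ: "pt w \<in> Q"
      using separator_exists[of v x w] mem x vw by metis
    note sep' = separator_sym[OF sep]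
    define A where "A = {u \<in> W. pt u \<in> P}"
    define B where "B = {u \<in> W. pt u \<in> Q}"
    have ptW: "pt u \<in> P \<or> pt u \<in> Q \<longleftrightarrow> u \<noteq> v \<and> u \<noteq> x" "\<not> (pt u \<in> P \<and> pt u \<in> Q)" if "u \<in> W" for u
      using separator_pt(2,3)[OF sep mem(1,2), of u] W that by blast+
    have AB: "A \<inter> B = {}" "v \<notin> A" "x \<notin> A" "v \<notin> B" "x \<notin> B" "w \<in> B"
      using ptW v x w wQ unfolding A_def B_def by auto
    have Weq: "W = (A \<union> {v, x}) \<union> (B \<union> {x})"
      using ptW v x unfolding A_def B_def by auto
    have fin: "finite A" "finite B" using finW unfolding A_def B_def by auto
    have cardW: "card W = card A + card B + 2"
    proof -
      have "W = (A \<union> B) \<union> {v, x}" using Weq by blast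
      moreover have "(A \<union> B) \<inter> {v, x} = {}" using AB by blast
      ultimately have "card W = card (A \<union> B) + card {v, x}"
        using fin by (simp only: card_Un_disjoint finite_Un finite.intros)
      then show ?thesis using fin AB(1) x(2) by (simp add: card_Un_disjoint)
    qed
    have cA: "card (A \<union> {v, x}) = card A + 2"
      using fin AB x(2) by simp
    have cB: "card (B \<union> {x}) = card B + 1"
      using fin AB by simp
    \<comment> \<open>Since \<open>w\<close> is in \<open>B\<close>, the set
      \<open>A \<union> {v, x}\<close> is smaller than \<open>W\<close>, and
      \<open>2 * card (B \<union> {x}) - 3\<close> is a true subtraction. An empty \<open>A\<close>
      is harmless: the first part is then just \<open>{v, x}\<close>.\<close>
    have B1: "card B \<ge> 1"
      using AB(6) fin(2) by (metis One_nat_def Suc_leI card_gt_0_iff empty_iff)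
    obtain E1 p1 where E1: "E1 \<subseteq> all_edges (A \<union> {v, x})" "\<forall>e\<in>E1. \<forall>f\<in>E1. \<not> cross e f"
      "2 * card (A \<union> {v, x}) - 3 \<le> card E1" "hamiltonian_path (A \<union> {v, x}) E1 v x p1"
      using less.hyps[of "A \<union> {v, x}" v x] cardW cA B1 Weq W x by auto
    obtain E2 p2 where E2: "E2 \<subseteq> all_edges (B \<union> {x})" "\<forall>e\<in>E2. \<forall>f\<in>E2. \<not> cross e f"
      "2 * card (B \<union> {x}) - 3 \<le> card E2" "hamiltonian_path (B \<union> {x}) E2 x w p2"
      using less.hyps[of "B \<union> {x}" x w] cardW cB Weq W x AB(6) by auto
    \<comment> \<open>Excluding \<open>x\<close> matters: \<open>vx\<close> may already be in
      \<open>E1\<close>, whereas \<open>vz\<close> with \<open>z\<close> in \<open>B\<close> is new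
      and runs on the side \<open>Q\<close>.\<close>
    have "B \<union> {x} \<subseteq> V - {v}" using W Weq AB x by auto
    then obtain z where z: "z \<in> B \<union> {x}" "z \<noteq> x" "\<forall>f\<in>E2. \<not> cross {v, z} f"
      using second_uncrossed_edge[OF mem(1) _ E2(1), of x w] E2(2) AB(6) x(3) by blast
    then have zB: "z \<in> B" by blast
    have zv: "z \<noteq> v" using zB AB by blast
    define E where "E = insert {v, z} (E1 \<union> E2)"
    have sub: "A \<union> {v, x} \<subseteq> V" "B \<union> {x} \<subseteq> V" using W Weq by auto
    \<comment> \<open>The edge \<open>vx\<close> may belong to \<open>E1\<close> and lies on
      \<open>C\<close>; hence \<open>P \<union> C\<close> here, but \<open>Q\<close> alone for the
      remaining edges.\<close>
    have side1: "e \<in> edges D \<and> edge_image D e - pt ` {v, x} \<subseteq> P \<union> C" if "e \<in> E1" for e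
    proof
      show e: "e \<in> edges D" using that E1(1) all_edges_mono_edges[OF sub(1)] by blast
      have "e \<subseteq> A \<union> {v, x}" using that E1(1) unfolding all_edges_def by blast
      then show "edge_image D e - pt ` {v, x} \<subseteq> P \<union> C"
        using separator_edge_side(1)[OF sep mem(1,2) e] unfolding A_def by blast
    qed
    have side2: "e \<in> edges D \<and> edge_image D e - pt ` {v, x} \<subseteq> Q" if "e \<in> insert {v, z} E2" for e
    proof
      have eB: "e = {v, z} \<or> e \<in> all_edges (B \<union> {x})" using that E2(1) by blast
      then show e: "e \<in> edges D"
        using all_edges_mono_edges[OF sub(2)] edge_mem mem zB zv sub(2) by blast
      have "u = v \<or> u = x \<or> pt u \<in> Q" if "u \<in> e" for u
        using eB that zB unfolding all_edges_def B_def by auto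
      moreover have "e \<noteq> {v, x}"
      proof
        assume e: "e = {v, x}"
        then have "e \<noteq> {v, z}" using z(2) x(2) by (auto simp: doubleton_eq_iff)
        then have "v \<in> B \<union> {x}" using eB e unfolding all_edges_def by blast
        then show False using AB x(2) by blast
      qed
      ultimately show "edge_image D e - pt ` {v, x} \<subseteq> Q"
        using separator_edge_side(2)[OF sep' mem(1,2) e] by blast
    qed
    have nc12: "\<not> cross e f" if "e \<in> E1" "f \<in> insert {v, z} E2" for e f
      using separator_opposite_no_cross[OF sep mem(1,2)] side1[OF that(1)] side2[OF that(2)] by blast
    have nc2: "\<not> cross e f" if "e \<in> insert {v, z} E2" "f \<in> insert {v, z} E2" for e f
    proof -
      have "\<not> cross {v, z} {v, z}" unfolding cross_def by simp
      then show ?thesis using that E2(2) z(3) cross_sym by blast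
    qed
    have noncross: "\<forall>e\<in>E. \<forall>f\<in>E. \<not> cross e f"
    proof (intro ballI)
      fix e f assume "e \<in> E" "f \<in> E"
      then consider "e \<in> E1" "f \<in> E1" | "e \<in> E1" "f \<in> insert {v, z} E2"
        | "f \<in> E1" "e \<in> insert {v, z} E2" | "e \<in> insert {v, z} E2" "f \<in> insert {v, z} E2"
        unfolding E_def by blast
      then show "\<not> cross e f"
      proof cases
        case 1
        then show ?thesis using E1(2) by blast
      next
        case 2
        then show ?thesis by (rule nc12)
      next
        case 3
        then have "\<not> cross f e" by (rule nc12)
        then show ?thesis using cross_sym by blast
      next
        case 4
        then show ?thesis by (rule nc2)
      qed
    qed
    have EW: "E \<subseteq> all_edges W"
    proof -
      have "all_edges (A \<union> {v, x}) \<subseteq> all_edges W" "all_edges (B \<union> {x}) \<subseteq> all_edges W"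
        using Weq unfolding all_edges_def by auto
      moreover have "{v, z} \<in> all_edges W"
        using v zB zv unfolding all_edges_def B_def by simp
      ultimately show ?thesis unfolding E_def using E1(1) E2(1) by blast
    qed
    have "finite (all_edges W)" using finW unfolding all_edges_def by simp
    then have finE: "finite E1" "finite E2"
      using EW unfolding E_def by (auto intro: finite_subset)
    have "E1 \<inter> E2 = {}"
    proof -
      have False if "e \<in> E1" "e \<in> E2" for e
      proof -
        have "e \<subseteq> {x}" using that E1(1) E2(1) AB unfolding all_edges_def by blast
        moreover have "card e = 2" using that E1(1) unfolding all_edges_def by blast
        ultimately show False by (auto dest: subset_singletonD)
      qed
      then show ?thesis by blast
    qed
    moreover have "{v, z} \<notin> E1 \<union> E2"
      using E1(1) E2(1) zB zv z(2) AB x(2) unfolding all_edges_def by blast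
    ultimately have "card E = card E1 + card E2 + 1"
      unfolding E_def using finE by (simp add: card_Un_disjoint)
    \<comment> \<open>With a and b the cardinalities of \<open>A\<close> and \<open>B\<close>: (2a +
      1) + (2b - 1) + 1 = 2(a + b + 2) - 3.\<close>
    then have cardE: "2 * card W - 3 \<le> card E"
      using E1(3) E2(3) cA cB cardW B1 by simp
    have inter: "(A \<union> {v, x}) \<inter> (B \<union> {x}) = {x}" using AB x(2) by blast
    have "E1 \<subseteq> E" "E2 \<subseteq> E" unfolding E_def by auto
    then have "hamiltonian_path W E v w (p1 @ tl p2)"
      using hamiltonian_path_append[OF hamiltonian_path_mono[OF E1(4)] hamiltonian_path_mono[OF E2(4)] inter x(3)] Weq
      by simp
    then show ?thesis using EW noncross cardE by blast
  qed
qed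

end

theorem theorem9:
  fixes S :: "'a::euclidean_space set"
    and D :: "('v, 'a) drawing"
    and n :: nat
  assumes plane_or_sphere:
      "(DIM('a) = 2 \<and> S = UNIV) \<or> (DIM('a) = 3 \<and> S = sphere 0 1)"
    and "n \<ge> 2"
    and "drawing_of_complete_graph n D"
    and "separable_drawing S D"
  shows "\<forall>v\<in>verts D. \<forall>w\<in>verts D. v \<noteq> w \<longrightarrow>
           (\<exists>D'. subdrawing D' D \<and> crossing_free S D' \<and> card (edges D') \<ge> 2 * n - 3 \<and>
                 (\<exists>p. hamiltonian_path (verts D) (edges D') v w p))"
proof (intro ballI impI)
  fix v w assume vw: "v \<in> verts D" "w \<in> verts D" "v \<noteq> w"
  have complete: "edges D = all_edges (verts D)" and n: "card (verts D) = n"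
    using assms(3) unfolding drawing_of_complete_graph_def by auto
  interpret separable_complete_drawing S D
    by unfold_locales (use plane_or_sphere complete assms(4) in auto)
  obtain E p where E: "E \<subseteq> all_edges (verts D)" "\<forall>e\<in>E. \<forall>f\<in>E. \<not> cross e f"
    "2 * n - 3 \<le> card E" "hamiltonian_path (verts D) E v w p"
    using plane_hamiltonian_path[OF subset_refl vw] n by auto
  define D' where "D' = D\<lparr>verts := verts D, edges := E\<rparr>"
  have "subdrawing D' D"
    unfolding subdrawing_def D'_def using E(1) complete by blast
  moreover have "crossing_free S D'"
    unfolding crossing_free_def
  proof (intro ballI impI notI)
    fix e f
    assume "e \<in> edges D'" "f \<in> edges D'" "e \<noteq> f"
      and "\<exists>x. proper_crossing S (edge_image D' e) (edge_image D' f) x"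
    moreover from this have "e \<in> edges D" "f \<in> edges D" "\<not> cross e f"
      using E(1,2) complete unfolding D'_def by auto
    ultimately show False
      using not_proper_crossing unfolding D'_def by auto
  qed
  moreover have "edges D' = E" unfolding D'_def by simp
  ultimately show "\<exists>D'. subdrawing D' D \<and> crossing_free S D' \<and> card (edges D') \<ge> 2 * n - 3 \<and>
                 (\<exists>p. hamiltonian_path (verts D) (edges D') v w p)"
    using E(3,4) by blast
qed

end
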